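(* Let $f:\mathbb{R}\to\mathbb{R}$ be locally Lipschitz continuous, increasing and odd, with $f(0)=0$ and $xf(x)>0$ for all $x\neq 0$. Suppose that there exists $\epsilon_0\in(0,1)$ such that for every $\epsilon\in(0,\epsilon_0)$ $$\underline{\Phi}_f(\epsilon):=\liminf_{x\to 0^+}\frac{f((1-\epsilon)x)}{f(x)}>0,\qquad\text{and}\quad \underline{\Phi}_f(\epsilon)\to 1\ \text{ as } \epsilon\to 0^+,$$ and that $$\limsup_{x\to 0^+}\frac{f(\mu x)}{f(x)}<\mu\quad\text{for all }\mu\in(0,1).$$ Let $\sigma:[0,\infty)\to\mathbb{R}$ be continuous with $\sigma\notin L^2(0,\infty)$. Let $B$ be a one-dimensional standard Brownian motion, let $\xi\in\mathbb{R}$ be deterministic, and let $X$ be the unique continuous adapted process satisfying $$dX(t)=-f(X(t))\,dt+\sigma(t)\,dB(t),\quad t\ge 0,\qquad X(0)=\xi.$$ Then $$\mathbb{P}\left[\limsup_{t\to\infty}\frac{|X(t)|}{F^{-1}(t)}=+\infty\right]=1.$$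
   Context: $F:(0,\infty)\to\mathbb{R}$ is defined by $F(x)=\int_x^1 \frac{1}{f(u)}\,du$. It is strictly decreasing, and $F^{-1}$ denotes its inverse function. Under the stated hypotheses $F(x)\to+\infty$ as $x\to0^+$, so $F^{-1}(t)$ is defined for all $t\ge 0$. "Adapted" refers to the natural filtration generated by $B$. *)

theory Defs
  imports "HOL-Probability.Probability"
begin

text \<open>Processes are functions \<^typ>\<open>real \<Rightarrow> 'a \<Rightarrow> real\<close>, of which only the values at
  times \<open>t \<ge> 0\<close> matter.\<close>

definition natural_filtration :: "'a measure \<Rightarrow> (real \<Rightarrow> 'a \<Rightarrow> real) \<Rightarrow> real \<Rightarrow> 'a measure" where
  "natural_filtration M B t =
     sigma (space M) {B s -` A \<inter> space M | s A. 0 \<le> s \<and> s \<le> t \<and> A \<in> sets borel}"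

text \<open>Ito integrals are only determined up to null sets, so that a solution of a stochastic
  differential equation is in general adapted only after adding the null sets to the
  \<open>\<sigma>\<close>-algebras generated by the driving process. A process adapted to
  \<^const>\<open>natural_filtration\<close> is also adapted to the augmented filtration.\<close>

definition augmented_filtration :: "'a measure \<Rightarrow> (real \<Rightarrow> 'a \<Rightarrow> real) \<Rightarrow> real \<Rightarrow> 'a measure" where
  "augmented_filtration M B t =
     sigma (space M) (sets (natural_filtration M B t) \<union> null_sets M)"

definition adapted_process :: "(real \<Rightarrow> 'a measure) \<Rightarrow> (real \<Rightarrow> 'a \<Rightarrow> real) \<Rightarrow> bool" where
  "adapted_process F X \<longleftrightarrow> (\<forall>t\<ge>0. X t \<in> borel_measurable (F t))"

definition standard_brownian_motion :: "'a measure \<Rightarrow> (real \<Rightarrow> 'a \<Rightarrow> real) \<Rightarrow> bool" where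
  "standard_brownian_motion M B \<longleftrightarrow>
     prob_space M \<and>
     (\<forall>t\<ge>0. B t \<in> borel_measurable M) \<and>
     (AE \<omega> in M. B 0 \<omega> = 0) \<and>
     (\<forall>s t. 0 \<le> s \<and> s < t \<longrightarrow>
        distributed M lborel (\<lambda>\<omega>. B t \<omega> - B s \<omega>) (normal_density 0 (sqrt (t - s)))) \<and>
     (\<forall>s t. 0 \<le> s \<and> s < t \<longrightarrow>
        prob_space.indep_set M (sets (natural_filtration M B s))
          {(\<lambda>\<omega>. B t \<omega> - B s \<omega>) -` A \<inter> space M | A. A \<in> sets borel}) \<and>
     (AE \<omega> in M. continuous_on {0..} (\<lambda>t. B t \<omega>))"

text \<open>A simple process on \<open>[0, T]\<close> is given by partition points \<open>0 = p 0 \<le> \<dots> \<le> p n = T\<close> and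
  bounded \<open>F (p i)\<close>-measurable random variables \<open>h i\<close>, its value on \<open>(p i, p (i + 1)]\<close>.\<close>

definition is_simple_process ::
  "'a measure \<Rightarrow> (real \<Rightarrow> 'a measure) \<Rightarrow> real \<Rightarrow> nat \<Rightarrow> (nat \<Rightarrow> real) \<Rightarrow> (nat \<Rightarrow> 'a \<Rightarrow> real) \<Rightarrow> bool"
where
  "is_simple_process M F T n p h \<longleftrightarrow>
     p 0 = 0 \<and> p n = T \<and> (\<forall>i<n. p i \<le> p (Suc i)) \<and>
     (\<forall>i<n. h i \<in> borel_measurable (F (p i)) \<and> (\<exists>C. \<forall>\<omega>\<in>space M. \<bar>h i \<omega>\<bar> \<le> C))"

definition simple_value ::
  "nat \<Rightarrow> (nat \<Rightarrow> real) \<Rightarrow> (nat \<Rightarrow> 'a \<Rightarrow> real) \<Rightarrow> real \<Rightarrow> 'a \<Rightarrow> real" where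
  "simple_value n p h t \<omega> = (\<Sum>i<n. h i \<omega> * indicator {p i<..p (Suc i)} t)"

definition simple_integral_wrt ::
  "(real \<Rightarrow> 'a \<Rightarrow> real) \<Rightarrow> nat \<Rightarrow> (nat \<Rightarrow> real) \<Rightarrow> (nat \<Rightarrow> 'a \<Rightarrow> real) \<Rightarrow> 'a \<Rightarrow> real" where
  "simple_integral_wrt B n p h \<omega> = (\<Sum>i<n. h i \<omega> * (B (p (Suc i)) \<omega> - B (p i) \<omega>))"

text \<open>\<open>Z\<close> is a version of \<open>\<integral>\<^sub>0\<^sup>T H dB\<close>: it is the \<open>L\<^sup>2\<close>-limit of integrals of simple processes
  that converge to \<open>H\<close> in \<open>L\<^sup>2([0, T] \<times> \<Omega>)\<close>.\<close>

definition has_ito_integral ::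
  "'a measure \<Rightarrow> (real \<Rightarrow> 'a measure) \<Rightarrow> (real \<Rightarrow> 'a \<Rightarrow> real) \<Rightarrow> real \<Rightarrow> (real \<Rightarrow> 'a \<Rightarrow> real)
     \<Rightarrow> ('a \<Rightarrow> real) \<Rightarrow> bool" where
  "has_ito_integral M F B T H Z \<longleftrightarrow>
     (\<lambda>(t, \<omega>). H t \<omega>) \<in> borel_measurable (restrict_space lborel {0..T} \<Otimes>\<^sub>M M) \<and>
     Z \<in> borel_measurable M \<and>
     (\<exists>n p h.
        (\<forall>k::nat. is_simple_process M F T (n k) (p k) (h k)) \<and>
        (\<lambda>k. \<integral>\<^sup>+\<omega>. (\<integral>\<^sup>+t\<in>{0..T}.
            ennreal ((simple_value (n k) (p k) (h k) t \<omega> - H t \<omega>)\<^sup>2) \<partial>lborel) \<partial>M)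
          \<longlonglongrightarrow> 0 \<and>
        (\<lambda>k. \<integral>\<^sup>+\<omega>. ennreal ((simple_integral_wrt B (n k) (p k) (h k) \<omega> - Z \<omega>)\<^sup>2) \<partial>M)
          \<longlonglongrightarrow> 0)"

text \<open>\<open>X\<close> is a continuous adapted process with
  \<open>dX(t) = - f(X(t)) dt + \<sigma>(t) dB(t)\<close>, \<open>X(0) = \<xi>\<close>, read as the integral equation.\<close>

definition solves_sde ::
  "'a measure \<Rightarrow> (real \<Rightarrow> 'a \<Rightarrow> real) \<Rightarrow> (real \<Rightarrow> real) \<Rightarrow> (real \<Rightarrow> real) \<Rightarrow> real
     \<Rightarrow> (real \<Rightarrow> 'a \<Rightarrow> real) \<Rightarrow> bool" where
  "solves_sde M B f \<sigma> \<xi> X \<longleftrightarrow>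
     adapted_process (augmented_filtration M B) X \<and>
     (\<forall>\<omega>\<in>space M. continuous_on {0..} (\<lambda>t. X t \<omega>)) \<and>
     (AE \<omega> in M. X 0 \<omega> = \<xi>) \<and>
     (\<exists>I. (\<forall>t\<ge>0. has_ito_integral M (augmented_filtration M B) B t (\<lambda>s _. \<sigma> s) (I t)) \<and>
          (AE \<omega> in M. \<forall>t\<ge>0. X t \<omega> = \<xi> - (LBINT s:{0..t}. f (X s \<omega>)) + I t \<omega>))"

definition Phi_lower :: "(real \<Rightarrow> real) \<Rightarrow> real \<Rightarrow> ereal" where
  "Phi_lower f \<epsilon> = Liminf (at_right 0) (\<lambda>x. ereal (f ((1 - \<epsilon>) * x) / f x))"

text \<open>The interval integral is oriented, so that \<open>F_fun f x < 0\<close> for \<open>x > 1\<close>.\<close>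

definition F_fun :: "(real \<Rightarrow> real) \<Rightarrow> real \<Rightarrow> real" where
  "F_fun f x = (LBINT u=x..1. 1 / f u)"

definition F_inv :: "(real \<Rightarrow> real) \<Rightarrow> real \<Rightarrow> real" where
  "F_inv f = the_inv_into {0<..} (F_fun f)"

end

theory Submission
  imports Defs
begin

text \<open>Write \<open>y = F_inv f\<close>, the solution of \<open>y' = - f(y)\<close>, \<open>y(0) = 1\<close>, and let \<open>I\<close> be the
  stochastic integral of \<open>\<sigma>\<close>. If \<open>\<bar>X\<bar> \<le> K y\<close> from some time on, then, since positivity of
  \<open>Phi_lower f \<epsilon>\<close> for a single \<open>\<epsilon>\<close> iterates to \<open>f(K x) \<le> C f(x)\<close> near \<open>0\<close>, the drift satisfies
  \<open>\<bar>f(X)\<bar> \<le> C f(y) = - C y'\<close>, which has a finite integral. The integral equation then forces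
  \<open>I\<close> to stay bounded. But \<open>I(n)\<close> is spread out on the scale \<open>(\<integral>\<^sub>0\<^sup>n \<sigma>\<^sup>2)\<^sup>1\<^sup>/\<^sup>2 \<rightarrow> \<infinity>\<close>,
  so the probability that \<open>I\<close> stays bounded is zero.

  For the spreading, the random coefficients of the simple processes approximating \<open>\<sigma>\<close> are
  replaced by their means on the same partition. As \<open>\<sigma>\<close> is deterministic, the bias-variance
  decomposition shows that this does not increase the \<open>L\<^sup>2\<close> error, and it turns the approximating
  integrals into Gaussian variables.\<close>

subsection \<open>The augmented Brownian filtration\<close>

lemma space_natural_filtration [simp]: "space (natural_filtration M B t) = space M"
  unfolding natural_filtration_def by (rule space_measure_of) auto

lemma sets_natural_filtration:
  "sets (natural_filtration M B t) =
     sigma_sets (space M) {B s -` A \<inter> space M | s A. 0 \<le> s \<and> s \<le> t \<and> A \<in> sets borel}"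
  unfolding natural_filtration_def by (rule sets_measure_of) auto

lemma augmented_generator_subset:
  "sets (natural_filtration M B t) \<union> null_sets M \<subseteq> Pow (space M)"
  using sets.sets_into_space[of _ "natural_filtration M B t"] null_setsD2[of _ M]
    sets.sets_into_space[of _ M] by auto

lemma space_augmented_filtration [simp]: "space (augmented_filtration M B t) = space M"
  unfolding augmented_filtration_def by (rule space_measure_of) (rule augmented_generator_subset)

lemma sets_augmented_filtration:
  "sets (augmented_filtration M B t) =
     sigma_sets (space M) (sets (natural_filtration M B t) \<union> null_sets M)"
  unfolding augmented_filtration_def by (rule sets_measure_of) (rule augmented_generator_subset)

lemma natural_filtration_mono:
  "s \<le> t \<Longrightarrow> sets (natural_filtration M B s) \<subseteq> sets (natural_filtration M B t)"
  unfolding sets_natural_filtration by (rule sigma_sets_mono') force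

lemma subalgebra_augmented_filtration_mono:
  "s \<le> t \<Longrightarrow> subalgebra (augmented_filtration M B t) (augmented_filtration M B s)"
  unfolding subalgebra_def sets_augmented_filtration space_augmented_filtration
  using natural_filtration_mono[of s t M B] by (auto intro!: sigma_sets_mono')

lemma measurable_augmented_filtration_mono:
  "s \<le> t \<Longrightarrow> Y \<in> borel_measurable (augmented_filtration M B s) \<Longrightarrow>
    Y \<in> borel_measurable (augmented_filtration M B t)"
  using measurable_from_subalg subalgebra_augmented_filtration_mono by blast

lemma brownian_measurable_augmented_filtration:
  assumes "0 \<le> s" "s \<le> t"
  shows "B s \<in> borel_measurable (augmented_filtration M B t)"
proof (rule measurableI)
  fix A :: "real set" assume "A \<in> sets borel"
  then have "B s -` A \<inter> space M \<in> sets (natural_filtration M B t)"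
    unfolding sets_natural_filtration using assms by blast
  then show "B s -` A \<inter> space (augmented_filtration M B t) \<in> sets (augmented_filtration M B t)"
    unfolding sets_augmented_filtration space_augmented_filtration by blast
qed simp

locale brownian_motion = prob_space M for M :: "'a measure" +
  fixes B :: "real \<Rightarrow> 'a \<Rightarrow> real"
  assumes brownian: "standard_brownian_motion M B"
begin

abbreviation \<F> :: "real \<Rightarrow> 'a measure" where
  "\<F> \<equiv> augmented_filtration M B"

lemma natural_filtration_subset: "sets (natural_filtration M B t) \<subseteq> sets M"
proof -
  have "B s -` A \<inter> space M \<in> sets M" if "0 \<le> s" "A \<in> sets borel" for s A
    using brownian that unfolding standard_brownian_motion_def by (auto intro: measurable_sets)
  then show ?thesis
    unfolding sets_natural_filtration by (intro sets.sigma_sets_subset) auto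
qed

lemma subalgebra_augmented: "subalgebra M (\<F> t)"
  unfolding subalgebra_def sets_augmented_filtration space_augmented_filtration
  using natural_filtration_subset[of t] by (auto intro!: sets.sigma_sets_subset)

lemma measurable_augmented: "Y \<in> borel_measurable (\<F> t) \<Longrightarrow> Y \<in> borel_measurable M"
  using measurable_from_subalg subalgebra_augmented by blast

lemma increment_distributed:
  "0 \<le> s \<Longrightarrow> s < t \<Longrightarrow>
    distributed M lborel (\<lambda>\<omega>. B t \<omega> - B s \<omega>) (normal_density 0 (sqrt (t - s)))"
  using brownian unfolding standard_brownian_motion_def by blast

text \<open>Null sets are independent of every event, so joining them to the natural filtration
  keeps the product rule. The enlarged family is still stable under intersections, because a null
  set met with an event is null; hence independence passes to the sigma-algebra it generates, which
  is \<open>\<F> s\<close>.\<close>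

lemma indep_increment:
  assumes "0 \<le> s" "s < t" and Y: "Y \<in> borel_measurable (\<F> s)"
  shows "indep_var borel Y borel (\<lambda>\<omega>. B t \<omega> - B s \<omega>)"
proof -
  let ?D = "\<lambda>\<omega>. B t \<omega> - B s \<omega>"
  let ?N = "sets (natural_filtration M B s)"
  let ?G = "{?D -` A \<inter> space M | A. A \<in> sets borel}"
  have D: "?D \<in> borel_measurable M"
    using increment_distributed[OF assms(1,2)] by (auto dest: distributed_measurable)
  have ind: "indep_set ?N ?G"
    using brownian assms unfolding standard_brownian_motion_def by blast
  have G: "?G \<subseteq> sets M" using D by auto
  have "indep_set (?N \<union> null_sets M) ?G"
  proof (rule indep_setI)
    show "?N \<union> null_sets M \<subseteq> events" using natural_filtration_subset by auto
    fix a b assume a: "a \<in> ?N \<union> null_sets M" and b: "b \<in> ?G"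
    show "prob (a \<inter> b) = prob a * prob b"
    proof (cases "a \<in> ?N")
      case True then show ?thesis using indep_setD[OF ind _ b] by simp
    next
      case False
      with a have "a \<in> null_sets M" by simp
      moreover from this have "a \<inter> b \<in> null_sets M"
        using b G by (intro null_set_Int2) auto
      ultimately show ?thesis by (simp add: measure_eq_0_null_sets)
    qed
  qed (rule G)
  moreover have "Int_stable (?N \<union> null_sets M)"
    unfolding Int_stable_def using natural_filtration_subset[of s]
    by (auto intro: null_set_Int1 null_set_Int2)
  moreover have "Int_stable ?G"
  proof (rule Int_stableI)
    fix a b assume "a \<in> ?G" "b \<in> ?G"
    then obtain A A' where "A \<in> sets borel" "A' \<in> sets borel"
      "a = ?D -` A \<inter> space M" "b = ?D -` A' \<inter> space M" by blast
    then have "a \<inter> b = ?D -` (A \<inter> A') \<inter> space M" "A \<inter> A' \<in> sets borel" by auto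
    then show "a \<inter> b \<in> ?G" by blast
  qed
  ultimately have *: "indep_set (sets (\<F> s)) (sigma_sets (space M) ?G)"
    unfolding sets_augmented_filtration by (rule indep_set_sigma_sets)
  \<comment> \<open>The sigma-algebra generated by \<open>Y\<close> lies inside
    \<open>\<F> s\<close> and inherits the independence.\<close>
  have Ysub: "sigma_sets (space M) {Y -` A \<inter> space M | A. A \<in> sets borel} \<subseteq> sets (\<F> s)"
    using measurable_sets[OF Y]
      sets.sigma_sets_subset[of "{Y -` A \<inter> space M | A. A \<in> sets borel}" "\<F> s"] by auto
  have "indep_set (sigma_sets (space M) {Y -` A \<inter> space M | A. A \<in> sets borel})
      (sigma_sets (space M) ?G)"
  proof (rule indep_setI)
    show "sigma_sets (space M) {Y -` A \<inter> space M | A. A \<in> sets borel} \<subseteq> events"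
      using Ysub subalgebra_augmented[of s] unfolding subalgebra_def by blast
    show "sigma_sets (space M) ?G \<subseteq> events" using G by (rule sets.sigma_sets_subset)
  qed (use indep_setD[OF *] Ysub in blast)
  then show ?thesis
    unfolding indep_var_eq using D measurable_augmented[OF Y] by simp
qed

lemma increment_moments:
  assumes "0 \<le> s" "s < t"
  shows "integrable M (\<lambda>\<omega>. B t \<omega> - B s \<omega>)" "expectation (\<lambda>\<omega>. B t \<omega> - B s \<omega>) = 0"
    "integrable M (\<lambda>\<omega>. (B t \<omega> - B s \<omega>)\<^sup>2)" "expectation (\<lambda>\<omega>. (B t \<omega> - B s \<omega>)\<^sup>2) = t - s"
proof -
  note D = increment_distributed[OF assms]
  have pos: "0 < sqrt (t - s)" using assms by simp
  show "integrable M (\<lambda>\<omega>. B t \<omega> - B s \<omega>)"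
    using distributed_integrable[OF D, of "\<lambda>x. x"] integrable_normal_moment_nz_1[OF pos, of 0]
    by simp
  show E: "expectation (\<lambda>\<omega>. B t \<omega> - B s \<omega>) = 0"
    by (rule normal_distributed_expectation[OF pos D])
  show "integrable M (\<lambda>\<omega>. (B t \<omega> - B s \<omega>)\<^sup>2)"
    using distributed_integrable[OF D, of "\<lambda>x. x\<^sup>2"] integrable_normal_moment[OF pos, of 0 2]
    by simp
  show "expectation (\<lambda>\<omega>. (B t \<omega> - B s \<omega>)\<^sup>2) = t - s"
    using normal_distributed_variance[OF pos D] assms unfolding E by simp
qed

end

subsection \<open>Integrals of simple processes\<close>

context brownian_motion
begin

text \<open>\<open>0 \<le> p n\<close> is carried through the induction because \<open>B\<close> is
  known to be adapted at nonnegative times only.\<close>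

lemma simple_integral_measurable:
  assumes "0 \<le> p 0" "\<And>i. i < n \<Longrightarrow> p i \<le> p (Suc i)"
    and "\<And>i. i < n \<Longrightarrow> c i \<in> borel_measurable (\<F> (p i))"
  shows "0 \<le> p n \<and> simple_integral_wrt B n p c \<in> borel_measurable (\<F> (p n))"
  using assms(2,3)
proof (induction n)
  case 0
  then show ?case using assms(1) by (simp add: simple_integral_wrt_def[abs_def])
next
  case (Suc n)
  then have IH: "0 \<le> p n" "simple_integral_wrt B n p c \<in> borel_measurable (\<F> (p n))"
    and le: "p n \<le> p (Suc n)" and c: "c n \<in> borel_measurable (\<F> (p n))" by auto
  note [measurable] = measurable_augmented_filtration_mono[OF le IH(2)]
    measurable_augmented_filtration_mono[OF le c]
    brownian_measurable_augmented_filtration[OF IH(1) le]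
    brownian_measurable_augmented_filtration[of "p (Suc n)" "p (Suc n)" B M]
  have "0 \<le> p (Suc n)" using IH le by simp
  moreover have "(\<lambda>\<omega>. simple_integral_wrt B n p c \<omega> + c n \<omega> * (B (p (Suc n)) \<omega> - B (p n) \<omega>))
      \<in> borel_measurable (\<F> (p (Suc n)))"
    using \<open>0 \<le> p (Suc n)\<close> by measurable
  ultimately show ?case
    by (simp add: simple_integral_wrt_def[abs_def])
qed

text \<open>Induction on the last interval. Its coefficient, also when multiplied by the integral so
  far, is known at time \<open>p n\<close> and thus independent of the centred increment: the cross
  term has mean zero and the squared term factors. Boundedness of the coefficients makes all
  products integrable.\<close>

proposition ito_isometry_simple:
  assumes p0: "0 \<le> p 0" and "\<And>i. i < n \<Longrightarrow> p i \<le> p (Suc i)"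
    and "\<And>i. i < n \<Longrightarrow> c i \<in> borel_measurable (\<F> (p i))"
    and "\<And>i. i < n \<Longrightarrow> \<exists>C. \<forall>\<omega>\<in>space M. \<bar>c i \<omega>\<bar> \<le> C"
  shows "integrable M (\<lambda>\<omega>. (simple_integral_wrt B n p c \<omega>)\<^sup>2) \<and>
    expectation (\<lambda>\<omega>. (simple_integral_wrt B n p c \<omega>)\<^sup>2) =
      (\<Sum>i<n. expectation (\<lambda>\<omega>. (c i \<omega>)\<^sup>2) * (p (Suc i) - p i))"
  using assms(2-)
proof (induction n)
  case 0
  then show ?case by (simp add: simple_integral_wrt_def)
next
  case (Suc n)
  let ?S = "simple_integral_wrt B n p c"
  have le: "p n \<le> p (Suc n)" and c: "c n \<in> borel_measurable (\<F> (p n))"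
    using Suc.prems by auto
  have IH: "integrable M (\<lambda>\<omega>. (?S \<omega>)\<^sup>2)"
    "expectation (\<lambda>\<omega>. (?S \<omega>)\<^sup>2) = (\<Sum>i<n. expectation (\<lambda>\<omega>. (c i \<omega>)\<^sup>2) * (p (Suc i) - p i))"
    using Suc by auto
  have S: "0 \<le> p n" "?S \<in> borel_measurable (\<F> (p n))"
    using simple_integral_measurable[of p n c] p0 Suc.prems by auto
  show ?case
  proof (cases "p n = p (Suc n)")
    \<comment> \<open>An empty interval contributes nothing; it is treated apart because the law of
      an increment is given for strictly ordered times.\<close>
    case True
    then show ?thesis using IH by (simp add: simple_integral_wrt_def)
  next
    case False
    with le have lt: "p n < p (Suc n)" by simp
    let ?D = "\<lambda>\<omega>. B (p (Suc n)) \<omega> - B (p n) \<omega>"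
    obtain C where C: "\<And>\<omega>. \<omega> \<in> space M \<Longrightarrow> \<bar>c n \<omega>\<bar> \<le> C" using Suc.prems by blast
    have SM [measurable]: "?S \<in> borel_measurable M" and cM [measurable]: "c n \<in> borel_measurable M"
      using S c measurable_augmented by auto
    have iS: "integrable M ?S" using IH(1) by (rule square_integrable_imp_integrable[OF SM])
    have iSc: "integrable M (\<lambda>\<omega>. c n \<omega> * ?S \<omega>)"
      by (rule Bochner_Integration.integrable_bound[of _ "\<lambda>\<omega>. C * ?S \<omega>"])
        (use iS C in \<open>auto simp: abs_mult intro!: AE_I2 mult_right_mono intro: order_trans[OF _ abs_ge_self]\<close>)
    have ic2: "integrable M (\<lambda>\<omega>. (c n \<omega>)\<^sup>2)"
      by (rule integrable_const_bound[of _ "C\<^sup>2"])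
        (use C in \<open>auto intro!: AE_I2 simp: abs_le_square_iff[symmetric] intro: order_trans[OF _ abs_ge_self]\<close>)
    have mSc: "(\<lambda>\<omega>. c n \<omega> * ?S \<omega>) \<in> borel_measurable (\<F> (p n))"
      and mc2: "(\<lambda>\<omega>. (c n \<omega>)\<^sup>2) \<in> borel_measurable (\<F> (p n))"
      using S c by measurable
    note mom = increment_moments[OF S(1) lt]
    note i1 = indep_increment[OF S(1) lt mSc]
    have i2: "indep_var borel (\<lambda>\<omega>. (c n \<omega>)\<^sup>2) borel (\<lambda>\<omega>. (?D \<omega>)\<^sup>2)"
      using indep_var_compose[OF indep_increment[OF S(1) lt mc2], of "\<lambda>x. x" borel "\<lambda>x. x\<^sup>2" borel]
      by (simp add: comp_def)
    have int1: "integrable M (\<lambda>\<omega>. (c n \<omega> * ?S \<omega>) * ?D \<omega>)"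
      by (rule indep_var_integrable[OF i1 iSc mom(1)])
    have E1: "expectation (\<lambda>\<omega>. (c n \<omega> * ?S \<omega>) * ?D \<omega>) = 0"
      using indep_var_lebesgue_integral[OF i1 iSc mom(1)] mom(2) by simp
    have int2: "integrable M (\<lambda>\<omega>. (c n \<omega>)\<^sup>2 * (?D \<omega>)\<^sup>2)"
      by (rule indep_var_integrable[OF i2 ic2 mom(3)])
    have E2: "expectation (\<lambda>\<omega>. (c n \<omega>)\<^sup>2 * (?D \<omega>)\<^sup>2) =
        expectation (\<lambda>\<omega>. (c n \<omega>)\<^sup>2) * (p (Suc n) - p n)"
      using indep_var_lebesgue_integral[OF i2 ic2 mom(3)] mom(4) by simp
    have eq: "(simple_integral_wrt B (Suc n) p c \<omega>)\<^sup>2 =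
        (?S \<omega>)\<^sup>2 + 2 * ((c n \<omega> * ?S \<omega>) * ?D \<omega>) + (c n \<omega>)\<^sup>2 * (?D \<omega>)\<^sup>2" for \<omega>
      by (simp add: simple_integral_wrt_def power2_eq_square algebra_simps)
    show ?thesis
      unfolding eq using IH int1 int2 E1 E2 by simp
  qed
qed

text \<open>Constant coefficients scale the Gaussian increments, and each new term is independent of
  the sum so far, so the terms add up to a Gaussian whose variance is the sum of the
  variances.\<close>

proposition simple_integral_deterministic:
  fixes g p :: "nat \<Rightarrow> real"
  assumes "0 \<le> p 0" "\<And>i. i < n \<Longrightarrow> p i \<le> p (Suc i)"
  defines "v \<equiv> (\<Sum>i<n. (g i)\<^sup>2 * (p (Suc i) - p i))"
  assumes "0 < v"
  shows "distributed M lborel (simple_integral_wrt B n p (\<lambda>i _. g i)) (normal_density 0 (sqrt v))"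
proof -
  define V where "V k = (\<Sum>i<k. (g i)\<^sup>2 * (p (Suc i) - p i))" for k
  define S where "S k = simple_integral_wrt B k p (\<lambda>i _. g i)" for k
  \<comment> \<open>Initial coefficients or intervals may vanish. A partial sum is then the constant
    zero, which has no normal density, so the induction keeps this degenerate case separate.\<close>
  have "V k = 0 \<and> S k = (\<lambda>_. 0) \<or>
      V k > 0 \<and> distributed M lborel (S k) (normal_density 0 (sqrt (V k)))" if "k \<le> n" for k
    using that
  proof (induction k)
    case 0
    then show ?case by (simp add: V_def S_def simple_integral_wrt_def)
  next
    case (Suc k)
    let ?D = "\<lambda>\<omega>. B (p (Suc k)) \<omega> - B (p k) \<omega>"
    have Sm: "0 \<le> p k" "S k \<in> borel_measurable (\<F> (p k))"
      using simple_integral_measurable[of p k "\<lambda>i _. g i"] assms Suc.prems unfolding S_def by auto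
    have VS: "V (Suc k) = V k + (g k)\<^sup>2 * (p (Suc k) - p k)"
      "S (Suc k) = (\<lambda>\<omega>. S k \<omega> + g k * ?D \<omega>)"
      by (simp_all add: V_def S_def simple_integral_wrt_def fun_eq_iff)
    show ?case
    proof (cases "g k = 0 \<or> p k = p (Suc k)")
      case True
      then have "V (Suc k) = V k" "S (Suc k) = S k" unfolding VS by auto
      then show ?thesis using Suc by auto
    next
      case False
      then have g: "g k \<noteq> 0" and lt: "p k < p (Suc k)" using assms(2)[of k] Suc.prems by auto
      let ?\<tau> = "\<bar>g k\<bar> * sqrt (p (Suc k) - p k)"
      have \<tau>: "0 < ?\<tau>" "?\<tau>\<^sup>2 = (g k)\<^sup>2 * (p (Suc k) - p k)"
        using g lt by (auto simp: power_mult_distrib)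
      have D: "distributed M lborel (\<lambda>\<omega>. g k * ?D \<omega>) (normal_density 0 ?\<tau>)"
        using normal_density_affine[OF increment_distributed[OF Sm(1) lt], of "g k" 0] g lt by simp
      have I: "indep_var borel (S k) borel (\<lambda>\<omega>. g k * ?D \<omega>)"
        using indep_var_compose[OF indep_increment[OF Sm(1) lt Sm(2)],
            of "\<lambda>x. x" borel "\<lambda>x. g k * x" borel] by (simp add: comp_def)
      consider "V k = 0" "S k = (\<lambda>_. 0)" |
        "V k > 0" "distributed M lborel (S k) (normal_density 0 (sqrt (V k)))"
        using Suc by auto
      then show ?thesis
      proof cases
        case 1
        then show ?thesis unfolding VS using D \<tau> g lt
          by (simp add: real_sqrt_mult)
      next
        case 2
        have "distributed M lborel (\<lambda>\<omega>. S k \<omega> + g k * ?D \<omega>)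
            (normal_density (0 + 0) (sqrt ((sqrt (V k))\<^sup>2 + ?\<tau>\<^sup>2)))"
          using 2 \<tau> D by (intro add_indep_normal[OF I]) auto
        then show ?thesis unfolding VS using 2 \<tau> lt by (simp add: add_pos_nonneg)
      qed
    qed
  qed
  from this[of n] assms show ?thesis by (auto simp: V_def S_def)
qed

end

text \<open>The normal density never exceeds \<open>1 / s\<close>, and the interval has length
  \<open>2 * r\<close>.\<close>

lemma (in prob_space) normal_anticoncentration:
  assumes "0 < s" "distributed M lborel Y (normal_density 0 s)" "0 \<le> r"
  shows "\<P>(\<omega> in M. \<bar>Y \<omega>\<bar> \<le> r) \<le> 2 * r / s"
proof -
  have Y[measurable]: "Y \<in> borel_measurable M" using assms by (auto dest: distributed_measurable)
  have "emeasure M {\<omega>\<in>space M. \<bar>Y \<omega>\<bar> \<le> r} = emeasure M (Y -` {-r..r} \<inter> space M)"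
    by (rule arg_cong[where f="emeasure M"]) auto
  also have "\<dots> = (\<integral>\<^sup>+x. ennreal (normal_density 0 s x) * indicator {-r..r} x \<partial>lborel)"
    by (rule distributed_emeasure[OF assms(2)]) simp
  also have "\<dots> \<le> (\<integral>\<^sup>+x. ennreal (1 / s) * indicator {-r..r} x \<partial>lborel)"
  proof (intro nn_integral_mono mult_right_mono ennreal_leI)
    fix x
    have "s \<le> sqrt (2 * pi * s\<^sup>2)"
      using pi_ge_two assms(1) by (intro real_le_rsqrt) (simp add: mult_ge1_I)
    then have "1 / sqrt (2 * pi * s\<^sup>2) * exp (- (x - 0)\<^sup>2 / (2 * s\<^sup>2)) \<le> 1 / s * 1"
      using assms(1) by (intro mult_mono divide_left_mono) auto
    then show "normal_density 0 s x \<le> 1 / s" by (simp add: normal_density_def)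
  qed simp
  also have "\<dots> = ennreal (1 / s) * ennreal (2 * r)"
    using assms by (subst nn_integral_cmult_indicator) auto
  also have "\<dots> = ennreal (2 * r / s)"
    using assms by (simp add: ennreal_mult[symmetric])
  finally show ?thesis using assms by (simp add: emeasure_eq_measure)
qed

subsection \<open>Anticoncentration of Ito integrals\<close>

lemma partition_mono:
  fixes p :: "nat \<Rightarrow> real"
  assumes "\<And>i. i < n \<Longrightarrow> p i \<le> p (Suc i)" "i \<le> j" "j \<le> n"
  shows "p i \<le> p j"
  using assms(2,3)
proof (induction j)
  case (Suc j)
  then show ?case using assms(1)[of j] by (auto simp: le_Suc_eq)
qed simp

lemma simple_value_eq_0:
  assumes "\<And>i. i < n \<Longrightarrow> p i \<le> p (Suc i)" "p n < t"
  shows "simple_value n p h t \<omega> = 0"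
  unfolding simple_value_def
proof (intro sum.neutral ballI)
  fix i assume "i \<in> {..<n}"
  then have "p (Suc i) \<le> p n" using partition_mono[of n p "Suc i" n] assms(1) by simp
  then show "h i \<omega> * indicator {p i<..p (Suc i)} t = 0" using assms(2) by simp
qed

text \<open>The half-open intervals are disjoint, so no cross terms arise: on the last interval the
  earlier part of the sum vanishes.\<close>

lemma simple_value_square:
  assumes "\<And>i. i < n \<Longrightarrow> p i \<le> p (Suc i)"
  shows "(simple_value n p h t \<omega>)\<^sup>2 = simple_value n p (\<lambda>i \<omega>. (h i \<omega>)\<^sup>2) t \<omega>"
  using assms
proof (induction n)
  case (Suc n)
  have "simple_value n p h t \<omega> = 0" if "p n < t" "t \<le> p (Suc n)"
    using Suc.prems that by (intro simple_value_eq_0) auto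
  then have "(simple_value n p h t \<omega> + h n \<omega> * indicator {p n<..p (Suc n)} t)\<^sup>2 =
      (simple_value n p h t \<omega>)\<^sup>2 + (h n \<omega>)\<^sup>2 * indicator {p n<..p (Suc n)} t"
    by (auto split: split_indicator)
  then show ?case using Suc by (simp add: simple_value_def)
qed (simp add: simple_value_def)

text \<open>This reads the weighted sums of the Ito isometry and of the Gaussian variance as
  integrals over time.\<close>

lemma nn_integral_simple_value:
  assumes "\<And>i. i < n \<Longrightarrow> p i \<le> p (Suc i)" "\<And>i. i < n \<Longrightarrow> 0 \<le> a i"
  shows "(\<integral>\<^sup>+t\<in>{p 0..p n}. ennreal (simple_value n p (\<lambda>i _. a i) t \<omega>) \<partial>lborel) =
    ennreal (\<Sum>i<n. a i * (p (Suc i) - p i))"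
proof -
  have "(\<integral>\<^sup>+t\<in>{p 0..p n}. ennreal (simple_value n p (\<lambda>i _. a i) t \<omega>) \<partial>lborel) =
      (\<integral>\<^sup>+t. (\<Sum>i<n. ennreal (a i) * indicator {p i<..p (Suc i)} t) \<partial>lborel)"
  proof (intro nn_integral_cong)
    fix t
    have out: "indicator {p i<..p (Suc i)} t = (0::real)" if "i < n" "t \<notin> {p 0..p n}" for i
      using partition_mono[of n p 0 i] partition_mono[of n p "Suc i" n] assms(1) that by auto
    have "ennreal (simple_value n p (\<lambda>i _. a i) t \<omega>) =
        (\<Sum>i<n. ennreal (a i * indicator {p i<..p (Suc i)} t))"
      unfolding simple_value_def using assms(2) by (intro sum_ennreal[symmetric]) auto
    also have "\<dots> = (\<Sum>i<n. ennreal (a i) * indicator {p i<..p (Suc i)} t)"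
      by (intro sum.cong refl) (simp split: split_indicator)
    finally have eq: "ennreal (simple_value n p (\<lambda>i _. a i) t \<omega>) =
        (\<Sum>i<n. ennreal (a i) * indicator {p i<..p (Suc i)} t)" .
    have "simple_value n p (\<lambda>i _. a i) t \<omega> = 0" if "t \<notin> {p 0..p n}"
      unfolding simple_value_def using out that by (intro sum.neutral) auto
    then show "ennreal (simple_value n p (\<lambda>i _. a i) t \<omega>) * indicator {p 0..p n} t =
        (\<Sum>i<n. ennreal (a i) * indicator {p i<..p (Suc i)} t)"
      unfolding eq[symmetric] by (cases "t \<in> {p 0..p n}") auto
  qed
  also have "\<dots> = (\<Sum>i<n. ennreal (a i) * ennreal (p (Suc i) - p i))"
    using assms(1) by (subst nn_integral_sum) (auto simp: nn_integral_cmult_indicator)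
  also have "\<dots> = ennreal (\<Sum>i<n. a i * (p (Suc i) - p i))"
    using assms by (subst sum_ennreal[symmetric]) (auto simp: ennreal_mult intro!: sum.cong)
  finally show ?thesis .
qed

text \<open>The bias-variance decomposition: the mixed term vanishes because \<open>Y\<close> is
  centred.\<close>

lemma (in prob_space) nn_integral_square_deviation:
  assumes [measurable]: "Y \<in> borel_measurable M" and "integrable M (\<lambda>\<omega>. (Y \<omega>)\<^sup>2)" "expectation Y = 0"
  shows "(\<integral>\<^sup>+\<omega>. ennreal ((Y \<omega> + a)\<^sup>2) \<partial>M) = ennreal (expectation (\<lambda>\<omega>. (Y \<omega>)\<^sup>2)) + ennreal (a\<^sup>2)"
proof -
  have Y: "integrable M Y" by (rule square_integrable_imp_integrable) (use assms in auto)
  have eq: "(Y \<omega> + a)\<^sup>2 = (Y \<omega>)\<^sup>2 + 2 * a * Y \<omega> + a\<^sup>2" for \<omega>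
    by (simp add: power2_eq_square algebra_simps)
  have "integrable M (\<lambda>\<omega>. (Y \<omega> + a)\<^sup>2)" unfolding eq using assms Y by simp
  then have "(\<integral>\<^sup>+\<omega>. ennreal ((Y \<omega> + a)\<^sup>2) \<partial>M) = ennreal (expectation (\<lambda>\<omega>. (Y \<omega> + a)\<^sup>2))"
    by (rule nn_integral_eq_integral) simp
  also have "expectation (\<lambda>\<omega>. (Y \<omega> + a)\<^sup>2) = expectation (\<lambda>\<omega>. (Y \<omega>)\<^sup>2) + a\<^sup>2"
    unfolding eq using assms Y prob_space by simp
  finally show ?thesis by simp
qed

lemma ennreal_square_add_le:
  "ennreal ((x + y)\<^sup>2) \<le> 2 * ennreal (x\<^sup>2) + 2 * ennreal (y\<^sup>2)" for x y :: real
proof -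
  have "0 \<le> (x - y)\<^sup>2" by simp
  then have "(x + y)\<^sup>2 \<le> 2 * x\<^sup>2 + 2 * y\<^sup>2"
    unfolding power2_eq_square by (simp add: algebra_simps)
  then have "ennreal ((x + y)\<^sup>2) \<le> ennreal (2 * x\<^sup>2 + 2 * y\<^sup>2)" by (rule ennreal_leI)
  then show ?thesis by (simp add: ennreal_mult)
qed

context brownian_motion
begin

text \<open>The factors \<open>4\<close> come from comparing \<open>Z\<close> with a Gaussian variable of variance at least
  \<open>V / 4\<close> at distance at most \<open>4 \<delta>\<close> in squared \<open>L\<^sup>2\<close> norm.\<close>

lemma simple_approximation_anticoncentration:
  assumes simple: "is_simple_process M \<F> T n p h"
    and [measurable]: "s \<in> borel_measurable borel" "Z \<in> borel_measurable M"
    and d: "(\<integral>\<^sup>+\<omega>. (\<integral>\<^sup>+t\<in>{0..T}. ennreal ((simple_value n p h t \<omega> - s t)\<^sup>2) \<partial>lborel) \<partial>M) \<le> ennreal \<delta>"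
    and e: "(\<integral>\<^sup>+\<omega>. ennreal ((simple_integral_wrt B n p h \<omega> - Z \<omega>)\<^sup>2) \<partial>M) \<le> ennreal \<delta>"
    and V: "0 < V" "ennreal V \<le> (\<integral>\<^sup>+t\<in>{0..T}. ennreal ((s t)\<^sup>2) \<partial>lborel)"
    and \<delta>: "0 \<le> \<delta>" "\<delta> \<le> V / 4" and r: "0 \<le> r"
  shows "\<P>(\<omega> in M. \<bar>Z \<omega>\<bar> \<le> r) \<le> 4 * (r + 1) / sqrt V + 4 * \<delta>"
proof -
  interpret P: pair_sigma_finite lborel M ..
  \<comment> \<open>Each coefficient is split into its mean \<open>g i\<close> and a centred
    fluctuation \<open>c i\<close>, which is still bounded and known at time
    \<open>p i\<close>.\<close>
  define g where "g i = expectation (h i)" for i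
  define c where "c i \<omega> = h i \<omega> - g i" for i \<omega>
  have p: "p 0 = 0" "p n = T" "\<And>i. i < n \<Longrightarrow> p i \<le> p (Suc i)"
    and hF: "\<And>i. i < n \<Longrightarrow> h i \<in> borel_measurable (\<F> (p i))"
    and hb: "\<And>i. i < n \<Longrightarrow> \<exists>C. \<forall>\<omega>\<in>space M. \<bar>h i \<omega>\<bar> \<le> C"
    using simple unfolding is_simple_process_def by auto
  have hM [measurable]: "h i \<in> borel_measurable M" if "i < n" for i
    using measurable_augmented hF that by blast
  have hint: "integrable M (h i)" if "i < n" for i
    using hb[OF that] hM[OF that] by (auto intro!: integrable_const_bound AE_I2)
  have cF: "c i \<in> borel_measurable (\<F> (p i))" if "i < n" for i
    unfolding c_def[abs_def] using hF[OF that] by measurable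
  have cM [measurable]: "c i \<in> borel_measurable M" if "i < n" for i
    using measurable_augmented cF that by blast
  have cb: "\<exists>C. \<forall>\<omega>\<in>space M. \<bar>c i \<omega>\<bar> \<le> C" if i: "i < n" for i
  proof -
    obtain C where "\<forall>\<omega>\<in>space M. \<bar>h i \<omega>\<bar> \<le> C" using hb[OF i] by blast
    then have "\<forall>\<omega>\<in>space M. \<bar>c i \<omega>\<bar> \<le> C + \<bar>g i\<bar>" unfolding c_def by fastforce
    then show ?thesis by blast
  qed
  have c2int: "integrable M (\<lambda>\<omega>. (c i \<omega>)\<^sup>2)" if i: "i < n" for i
  proof -
    obtain C where "\<forall>\<omega>\<in>space M. \<bar>c i \<omega>\<bar> \<le> C" using cb[OF i] by blast
    then have "\<forall>\<omega>\<in>space M. norm ((c i \<omega>)\<^sup>2) \<le> C\<^sup>2"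
      by (auto simp: abs_le_square_iff[symmetric] intro: order_trans[OF _ abs_ge_self])
    then show ?thesis using cM[OF i] by (auto intro!: integrable_const_bound[of _ "C\<^sup>2"] AE_I2)
  qed
  have cint: "integrable M (c i)" and cE: "expectation (c i) = 0" if "i < n" for i
    using hint[OF that] prob_space unfolding c_def[abs_def] by (simp_all add: g_def)
  define q where "q i = expectation (\<lambda>\<omega>. (c i \<omega>)\<^sup>2)" for i
  \<comment> \<open>The coefficients \<open>g\<close> and \<open>q\<close> are constant in the
    sample point, so the argument \<open>undefined\<close> is a mere placeholder.\<close>
  let ?sg = "\<lambda>t. simple_value n p (\<lambda>i _. g i) t (undefined :: 'a)"
  let ?sq = "\<lambda>t. simple_value n p (\<lambda>i _. q i) t (undefined :: 'a)"
  have sg_meas [measurable]: "?sg \<in> borel_measurable borel" "?sq \<in> borel_measurable borel"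
    unfolding simple_value_def by measurable

  \<comment> \<open>At a fixed time the fluctuation has variance \<open>?sq t\<close>, while the
    distance of the mean \<open>?sg t\<close> from the deterministic target \<open>s t\<close> is
    the bias.\<close>
  have inner: "(\<integral>\<^sup>+\<omega>. ennreal ((simple_value n p h t \<omega> - s t)\<^sup>2) \<partial>M) =
      ennreal (?sq t) + ennreal ((?sg t - s t)\<^sup>2)" for t
  proof -
    let ?Y = "simple_value n p c t"
    have Ym: "?Y \<in> borel_measurable M"
      unfolding simple_value_def[abs_def] by (intro borel_measurable_sum borel_measurable_times cM) auto
    have Y2: "(\<lambda>\<omega>. (?Y \<omega>)\<^sup>2) = (\<lambda>\<omega>. \<Sum>i<n. (c i \<omega>)\<^sup>2 * indicator {p i<..p (Suc i)} t)"
      using simple_value_square[of n p c t] p(3) by (auto simp: simple_value_def)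
    have "integrable M (\<lambda>\<omega>. (?Y \<omega>)\<^sup>2)" "expectation (\<lambda>\<omega>. (?Y \<omega>)\<^sup>2) = ?sq t"
      unfolding Y2 unfolding simple_value_def q_def using c2int
      by (auto intro!: Bochner_Integration.integrable_sum)
    moreover have "expectation ?Y = 0"
      unfolding simple_value_def[abs_def] using cint cE by simp
    moreover have "simple_value n p h t \<omega> - s t = ?Y \<omega> + (?sg t - s t)" for \<omega>
      unfolding simple_value_def c_def by (simp add: algebra_simps sum_subtractf)
    ultimately show ?thesis
      using nn_integral_square_deviation[OF Ym, of "?sg t - s t"] by (simp only:)
  qed
  \<comment> \<open>Fubini moves the expectation inside, where the decomposition applies at each
    time; the L2 error then splits into total variance and total squared bias, each at most
    \<open>\<delta>\<close>.\<close>
  have "(\<integral>\<^sup>+\<omega>. (\<integral>\<^sup>+t\<in>{0..T}. ennreal ((simple_value n p h t \<omega> - s t)\<^sup>2) \<partial>lborel) \<partial>M) =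
      (\<integral>\<^sup>+t. (\<integral>\<^sup>+\<omega>. ennreal ((simple_value n p h t \<omega> - s t)\<^sup>2) * indicator {0..T} t \<partial>M) \<partial>lborel)"
  proof (rule P.Fubini')
    have "(\<lambda>x. simple_value n p h (fst x) (snd x)) \<in> borel_measurable (lborel \<Otimes>\<^sub>M M)"
      unfolding simple_value_def
      by (intro borel_measurable_sum borel_measurable_times measurable_compose[OF measurable_snd hM]) auto
    then show "(\<lambda>(t, \<omega>). ennreal ((simple_value n p h t \<omega> - s t)\<^sup>2) * indicator {0..T} t)
        \<in> borel_measurable (lborel \<Otimes>\<^sub>M M)"
      unfolding case_prod_beta by measurable
  qed
  also have "\<dots> = (\<integral>\<^sup>+t. (ennreal (?sq t) + ennreal ((?sg t - s t)\<^sup>2)) * indicator {0..T} t \<partial>lborel)"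
    unfolding inner[symmetric]
  proof (intro nn_integral_cong)
    fix t
    have [measurable]: "simple_value n p h t \<in> borel_measurable M"
      unfolding simple_value_def[abs_def] by (intro borel_measurable_sum borel_measurable_times hM) auto
    show "(\<integral>\<^sup>+\<omega>. ennreal ((simple_value n p h t \<omega> - s t)\<^sup>2) * indicator {0..T} t \<partial>M) =
      (\<integral>\<^sup>+\<omega>. ennreal ((simple_value n p h t \<omega> - s t)\<^sup>2) \<partial>M) * indicator {0..T} t"
      by (rule nn_integral_multc) measurable
  qed
  also have "\<dots> = (\<integral>\<^sup>+t\<in>{0..T}. ennreal (?sq t) \<partial>lborel) +
      (\<integral>\<^sup>+t\<in>{0..T}. ennreal ((?sg t - s t)\<^sup>2) \<partial>lborel)"
    by (subst nn_integral_add[symmetric]) (auto simp: distrib_right)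
  finally have split: "(\<integral>\<^sup>+t\<in>{0..T}. ennreal (?sq t) \<partial>lborel) +
      (\<integral>\<^sup>+t\<in>{0..T}. ennreal ((?sg t - s t)\<^sup>2) \<partial>lborel) \<le> ennreal \<delta>"
    using d by simp

  let ?H = "simple_integral_wrt B n p h" and ?G = "simple_integral_wrt B n p (\<lambda>i _. g i)"
    and ?D = "simple_integral_wrt B n p c"
  have intM: "simple_integral_wrt B n p k \<in> borel_measurable M"
    if "\<And>i. i < n \<Longrightarrow> k i \<in> borel_measurable (\<F> (p i))" for k
    by (rule measurable_augmented[of _ "p n"]) (use simple_integral_measurable[of p n k] p that in auto)
  have [measurable]: "?H \<in> borel_measurable M" "?G \<in> borel_measurable M" "?D \<in> borel_measurable M"
    using intM[of h] intM[of "\<lambda>i _. g i"] intM[of c] hF cF by simp_all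
  have iso: "integrable M (\<lambda>\<omega>. (?D \<omega>)\<^sup>2)"
      "expectation (\<lambda>\<omega>. (?D \<omega>)\<^sup>2) = (\<Sum>i<n. q i * (p (Suc i) - p i))"
    using ito_isometry_simple[of p n c] p cF cb by (auto simp: q_def)
  \<comment> \<open>By the isometry, the integral of the fluctuations has exactly the total variance
    as its squared norm.\<close>
  have "(\<integral>\<^sup>+\<omega>. ennreal ((?D \<omega>)\<^sup>2) \<partial>M) = (\<integral>\<^sup>+t\<in>{0..T}. ennreal (?sq t) \<partial>lborel)"
    using nn_integral_eq_integral[OF iso(1)] iso(2) nn_integral_simple_value[of n p q "undefined :: 'a"] p
    by (simp add: q_def)
  also have "\<dots> \<le> ennreal \<delta>"
    using split by (rule order_trans[rotated]) simp
  finally have D: "(\<integral>\<^sup>+\<omega>. ennreal ((?D \<omega>)\<^sup>2) \<partial>M) \<le> ennreal \<delta>" .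

  \<comment> \<open>\<open>v\<close> is the variance of the Gaussian \<open>?G\<close>. Splitting
    \<open>s\<close> into \<open>?sg\<close> and the bias gives
    \<open>V \<le> 2 * v + 2 * \<delta>\<close>, and \<open>\<delta> \<le> V / 4\<close> then leaves
    \<open>v \<ge> V / 4\<close>.\<close>
  define v where "v = (\<Sum>i<n. (g i)\<^sup>2 * (p (Suc i) - p i))"
  have "0 \<le> v" unfolding v_def using p by (intro sum_nonneg) auto
  have sq: "ennreal ((s t)\<^sup>2) \<le> 2 * ennreal ((?sg t)\<^sup>2) + 2 * ennreal ((?sg t - s t)\<^sup>2)" for t
    using ennreal_square_add_le[of "?sg t" "s t - ?sg t"] by (simp add: power2_commute[of "s t"])
  have "ennreal V \<le> (\<integral>\<^sup>+t\<in>{0..T}. ennreal ((s t)\<^sup>2) \<partial>lborel)" by (rule V(2))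
  also have "\<dots> \<le> (\<integral>\<^sup>+t. 2 * (ennreal ((?sg t)\<^sup>2) * indicator {0..T} t) +
      2 * (ennreal ((?sg t - s t)\<^sup>2) * indicator {0..T} t) \<partial>lborel)"
    using sq by (intro nn_integral_mono) (simp split: split_indicator)
  also have "\<dots> = 2 * (\<integral>\<^sup>+t\<in>{0..T}. ennreal ((?sg t)\<^sup>2) \<partial>lborel) +
      2 * (\<integral>\<^sup>+t\<in>{0..T}. ennreal ((?sg t - s t)\<^sup>2) \<partial>lborel)"
    by (simp add: nn_integral_add nn_integral_cmult)
  also have "(\<integral>\<^sup>+t\<in>{0..T}. ennreal ((?sg t)\<^sup>2) \<partial>lborel) = ennreal v"
    using nn_integral_simple_value[of n p "\<lambda>i. (g i)\<^sup>2" "undefined :: 'a"] simple_value_square[of n p "\<lambda>i _. g i" _ "undefined :: 'a"] p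
    by (simp add: v_def)
  also have "2 * ennreal v + 2 * (\<integral>\<^sup>+t\<in>{0..T}. ennreal ((?sg t - s t)\<^sup>2) \<partial>lborel) \<le>
      2 * ennreal v + 2 * ennreal \<delta>"
    using split by (intro add_left_mono mult_left_mono) (auto intro: order_trans[rotated])
  also have "\<dots> = ennreal (2 * v + 2 * \<delta>)"
    using \<open>0 \<le> v\<close> \<delta> by (simp add: ennreal_mult)
  finally have "V \<le> 2 * v + 2 * \<delta>"
    using \<open>0 \<le> v\<close> \<delta> by (subst (asm) ennreal_le_iff) auto
  then have v: "V / 4 \<le> v" "0 < v" using V \<delta> by auto
  have gauss: "distributed M lborel ?G (normal_density 0 (sqrt v))"
    using simple_integral_deterministic[of p n g] p v unfolding v_def by auto
  have "\<P>(\<omega> in M. \<bar>?G \<omega>\<bar> \<le> r + 1) \<le> 2 * (r + 1) / sqrt v"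
    using v r by (intro normal_anticoncentration[OF _ gauss]) auto
  also have "\<dots> \<le> 2 * (r + 1) / sqrt (V / 4)"
    using v V r by (intro divide_left_mono) auto
  also have "\<dots> = 4 * (r + 1) / sqrt V" by (simp add: real_sqrt_divide)
  finally have G: "\<P>(\<omega> in M. \<bar>?G \<omega>\<bar> \<le> r + 1) \<le> 4 * (r + 1) / sqrt V" .

  \<comment> \<open>Since \<open>?H\<close> is the sum of \<open>?G\<close> and \<open>?D\<close>,
    passing to the means costs only the small term \<open>?D\<close>.\<close>
  have GZ: "?G \<omega> - Z \<omega> = (?H \<omega> - Z \<omega>) + - ?D \<omega>" for \<omega>
    unfolding simple_integral_wrt_def c_def by (simp add: algebra_simps sum_subtractf sum.distrib)
  have "(\<integral>\<^sup>+\<omega>. ennreal ((?G \<omega> - Z \<omega>)\<^sup>2) \<partial>M) \<le>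
      (\<integral>\<^sup>+\<omega>. 2 * ennreal ((?H \<omega> - Z \<omega>)\<^sup>2) + 2 * ennreal ((?D \<omega>)\<^sup>2) \<partial>M)"
    unfolding GZ using ennreal_square_add_le[of _ "- ?D _"] by (intro nn_integral_mono) auto
  also have "\<dots> = 2 * (\<integral>\<^sup>+\<omega>. ennreal ((?H \<omega> - Z \<omega>)\<^sup>2) \<partial>M) + 2 * (\<integral>\<^sup>+\<omega>. ennreal ((?D \<omega>)\<^sup>2) \<partial>M)"
    by (simp add: nn_integral_add nn_integral_cmult)
  also have "\<dots> \<le> 2 * ennreal \<delta> + 2 * ennreal \<delta>"
    using D e by (intro add_mono mult_left_mono) auto
  also have "\<dots> = ennreal (4 * \<delta>)"
    using \<delta> by (simp add: ennreal_mult[symmetric] ennreal_plus[symmetric] del: ennreal_plus flip: ennreal_numeral)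
  finally have dist: "(\<integral>\<^sup>+\<omega>. ennreal ((?G \<omega> - Z \<omega>)\<^sup>2) \<partial>M) \<le> ennreal (4 * \<delta>)" .

  \<comment> \<open>Where \<open>Z\<close> is at most \<open>r\<close> in modulus, either
    \<open>?G\<close> is at most \<open>r + 1\<close> or the two differ by more than 1; in the
    latter case the squared difference dominates the indicator, as in Chebyshev's
    inequality.\<close>
  have "emeasure M {\<omega>\<in>space M. \<bar>Z \<omega>\<bar> \<le> r} = (\<integral>\<^sup>+\<omega>. indicator {\<omega>\<in>space M. \<bar>Z \<omega>\<bar> \<le> r} \<omega> \<partial>M)"
    by simp
  also have "\<dots> \<le> (\<integral>\<^sup>+\<omega>. indicator {\<omega>\<in>space M. \<bar>?G \<omega>\<bar> \<le> r + 1} \<omega> + ennreal ((?G \<omega> - Z \<omega>)\<^sup>2) \<partial>M)"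
  proof (intro nn_integral_mono)
    fix \<omega> assume "\<omega> \<in> space M"
    have "1 \<le> ennreal ((?G \<omega> - Z \<omega>)\<^sup>2)" if "\<bar>Z \<omega>\<bar> \<le> r" "\<not> \<bar>?G \<omega>\<bar> \<le> r + 1"
    proof -
      have "1\<^sup>2 \<le> (?G \<omega> - Z \<omega>)\<^sup>2" using that by (intro abs_le_square_iff[THEN iffD1]) linarith
      then show ?thesis by simp
    qed
    then show "(indicator {\<omega>\<in>space M. \<bar>Z \<omega>\<bar> \<le> r} \<omega> :: ennreal) \<le>
        indicator {\<omega>\<in>space M. \<bar>?G \<omega>\<bar> \<le> r + 1} \<omega> + ennreal ((?G \<omega> - Z \<omega>)\<^sup>2)"
      using \<open>\<omega> \<in> space M\<close> by (auto split: split_indicator)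
  qed
  also have "\<dots> = emeasure M {\<omega>\<in>space M. \<bar>?G \<omega>\<bar> \<le> r + 1} + (\<integral>\<^sup>+\<omega>. ennreal ((?G \<omega> - Z \<omega>)\<^sup>2) \<partial>M)"
    by (subst nn_integral_add) auto
  also have "\<dots> \<le> ennreal (4 * (r + 1) / sqrt V) + ennreal (4 * \<delta>)"
    using G dist by (intro add_mono) (auto simp: emeasure_eq_measure intro: ennreal_leI)
  also have "\<dots> = ennreal (4 * (r + 1) / sqrt V + 4 * \<delta>)" using r V \<delta> by simp
  finally show ?thesis
    using r V \<delta> unfolding emeasure_eq_measure by (subst (asm) ennreal_le_iff) auto
qed

text \<open>The error term \<open>4 * \<delta>\<close> of the approximate bound disappears along the
  approximating sequence.\<close>

proposition ito_integral_anticoncentration: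
  assumes ito: "has_ito_integral M \<F> B T (\<lambda>t _. \<sigma> t) Z"
    and cont: "continuous_on {0..} \<sigma>"
    and V: "0 < V" "ennreal V \<le> (\<integral>\<^sup>+t\<in>{0..T}. ennreal ((\<sigma> t)\<^sup>2) \<partial>lborel)" and r: "0 \<le> r"
  shows "\<P>(\<omega> in M. \<bar>Z \<omega>\<bar> \<le> r) \<le> 4 * (r + 1) / sqrt V"
proof (rule field_le_epsilon)
  fix \<epsilon> :: real assume \<epsilon>: "0 < \<epsilon>"
  \<comment> \<open>The first entry makes \<open>\<delta>\<close> admissible for the approximate
    bound, the second absorbs \<open>4 * \<delta>\<close> into \<open>\<epsilon>\<close>.\<close>
  define \<delta> where "\<delta> = min (V / 4) (\<epsilon> / 4)"
  have \<delta>: "0 < \<delta>" "\<delta> \<le> V / 4" "4 * \<delta> \<le> \<epsilon>" using V \<epsilon> by (auto simp: \<delta>_def)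
  \<comment> \<open>Extension of \<open>\<sigma>\<close> by zero, Borel measurable on the whole line
    and equal to \<open>\<sigma>\<close> on \<open>{0..T}\<close>.\<close>
  define s where "s t = indicator {0..} t *\<^sub>R \<sigma> t" for t
  have [measurable]: "s \<in> borel_measurable borel"
    unfolding s_def[abs_def] by (rule borel_measurable_continuous_on_indicator[OF _ cont]) simp
  have s: "F (\<sigma> t) * indicator {0..T} t = F (s t) * indicator {0..T} t" for F :: "real \<Rightarrow> ennreal" and t
    by (simp add: s_def split: split_indicator)
  obtain n p h where simple: "\<And>k::nat. is_simple_process M \<F> T (n k) (p k) (h k)"
    and lim1: "(\<lambda>k. \<integral>\<^sup>+\<omega>. (\<integral>\<^sup>+t\<in>{0..T}.
            ennreal ((simple_value (n k) (p k) (h k) t \<omega> - \<sigma> t)\<^sup>2) \<partial>lborel) \<partial>M) \<longlonglongrightarrow> 0"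
    and lim2: "(\<lambda>k. \<integral>\<^sup>+\<omega>. ennreal ((simple_integral_wrt B (n k) (p k) (h k) \<omega> - Z \<omega>)\<^sup>2) \<partial>M)
          \<longlonglongrightarrow> 0"
    using ito unfolding has_ito_integral_def by blast
  have [measurable]: "Z \<in> borel_measurable M" using ito unfolding has_ito_integral_def by blast
  have "0 < ennreal \<delta>" using \<delta> by simp
  from eventually_conj[OF order_tendstoD(2)[OF lim1 this] order_tendstoD(2)[OF lim2 this]]
  obtain k where k: "(\<integral>\<^sup>+\<omega>. (\<integral>\<^sup>+t\<in>{0..T}.
            ennreal ((simple_value (n k) (p k) (h k) t \<omega> - \<sigma> t)\<^sup>2) \<partial>lborel) \<partial>M) < ennreal \<delta>"
    "(\<integral>\<^sup>+\<omega>. ennreal ((simple_integral_wrt B (n k) (p k) (h k) \<omega> - Z \<omega>)\<^sup>2) \<partial>M) < ennreal \<delta>"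
    by (auto dest!: eventually_happens'[OF sequentially_bot])
  have "\<P>(\<omega> in M. \<bar>Z \<omega>\<bar> \<le> r) \<le> 4 * (r + 1) / sqrt V + 4 * \<delta>"
  proof (rule simple_approximation_anticoncentration[OF simple[of k], of s])
    show "ennreal V \<le> (\<integral>\<^sup>+t\<in>{0..T}. ennreal ((s t)\<^sup>2) \<partial>lborel)"
      using V(2) unfolding s[of "\<lambda>x. ennreal (x\<^sup>2)"] .
    show "(\<integral>\<^sup>+\<omega>. (\<integral>\<^sup>+t\<in>{0..T}.
        ennreal ((simple_value (n k) (p k) (h k) t \<omega> - s t)\<^sup>2) \<partial>lborel) \<partial>M) \<le> ennreal \<delta>"
      using k(1) unfolding s[of "\<lambda>x. ennreal ((simple_value (n k) (p k) (h k) _ _ - x)\<^sup>2)"] by simp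
  qed (use k \<delta> V r in auto)
  then show "\<P>(\<omega> in M. \<bar>Z \<omega>\<bar> \<le> r) \<le> 4 * (r + 1) / sqrt V + \<epsilon>" using \<delta> by simp
qed

end

subsection \<open>The deterministic equation\<close>

locale drift_function =
  fixes f :: "real \<Rightarrow> real"
  assumes lipschitz: "local_lipschitz (UNIV :: real set) UNIV (\<lambda>_. f)"
    and zero: "f 0 = 0"
    and sign: "\<And>x. x \<noteq> 0 \<Longrightarrow> x * f x > 0"
begin

lemma continuous_drift: "continuous_on UNIV f"
  using local_lipschitz_continuous_on[OF lipschitz, of 0] by simp

lemma drift_pos: "0 < x \<Longrightarrow> 0 < f x"
  using sign[of x] by (simp add: zero_less_mult_iff)

text \<open>Local Lipschitz continuity and \<open>f 0 = 0\<close> bound \<open>f\<close> by a linear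
  function. This is what makes \<open>F_fun f\<close> diverge at zero.\<close>

lemma linear_bound_at_0:
  obtains u L where "0 < u" "u \<le> 1" "0 < L" "\<And>x. 0 < x \<Longrightarrow> x \<le> u \<Longrightarrow> f x \<le> L * x"
proof -
  obtain u L where u: "0 < u" and L: "\<And>s. s \<in> cball (0::real) u \<inter> UNIV \<Longrightarrow> L-lipschitz_on (cball 0 u \<inter> UNIV) f"
    using local_lipschitzE[OF lipschitz, of 0 0] by (metis UNIV_I)
  have lip: "L-lipschitz_on (cball 0 u) f" using L[of 0] u by simp
  have "f x \<le> max L 1 * x" if "0 < x" "x \<le> min u 1" for x
  proof -
    have "\<bar>f x\<bar> \<le> L * \<bar>x\<bar>"
      using lipschitz_onD[OF lip, of x 0] that zero by (simp add: dist_real_def)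
    also have "\<dots> \<le> max L 1 * \<bar>x\<bar>" by (intro mult_right_mono) auto
    finally show ?thesis using that by simp
  qed
  then show ?thesis using that[of "min u 1" "max L 1"] u by auto
qed

section \<open>The function \<open>F_fun f\<close>, its range and its inverse\<close>

lemma F_fun_has_derivative:
  assumes "0 < x"
  shows "(F_fun f has_real_derivative - (1 / f x)) (at x)"
proof -
  \<comment> \<open>A compact interval inside the positive half-line that has \<open>x\<close> in
    its interior and contains the base point 1, so that \<open>1 / f\<close> is continuous on
    it.\<close>
  define a b where "a = min x 1 / 2" and "b = max x 1 + 1"
  have ab: "0 < a" "a < x" "x < b" "a \<le> 1" "1 \<le> b" using assms by (auto simp: a_def b_def)
  have nz: "f u \<noteq> 0" if "u \<in> {a..b}" for u using drift_pos[of u] ab that by simp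
  have "continuous_on {a..b} (\<lambda>u. 1 / f u)"
    using nz by (intro continuous_intros continuous_on_subset[OF continuous_drift]) auto
  then have "((\<lambda>u. LBINT y=1..u. 1 / f y) has_vector_derivative (1 / f x)) (at x within {a..b})"
    using interval_integral_FTC2[of a 1 b "\<lambda>u. 1 / f u" x] ab
    by (simp add: one_ereal_def)
  then have "((\<lambda>u. LBINT y=1..u. 1 / f y) has_real_derivative (1 / f x)) (at x within {a..b})"
    by (simp add: has_real_derivative_iff_has_vector_derivative)
  then have "((\<lambda>u. LBINT y=1..u. 1 / f y) has_real_derivative (1 / f x)) (at x)"
    using ab by (simp add: at_within_Icc_at)
  then have "((\<lambda>u. - (LBINT y=1..u. 1 / f y)) has_real_derivative - (1 / f x)) (at x)"
    by (rule DERIV_minus)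
  moreover have "F_fun f = (\<lambda>u. - (LBINT y=1..u. 1 / f y))"
    unfolding F_fun_def by (subst interval_integral_endpoints_reverse) simp
  ultimately show ?thesis by simp
qed

lemma F_fun_1 [simp]: "F_fun f 1 = 0"
  by (simp add: F_fun_def one_ereal_def)

lemma continuous_F_fun: "0 < x \<Longrightarrow> isCont (F_fun f) x"
  using F_fun_has_derivative DERIV_isCont by blast

lemma F_fun_strict_decreasing:
  assumes "0 < x" "x < y"
  shows "F_fun f y < F_fun f x"
proof (rule DERIV_neg_imp_decreasing[OF assms(2)])
  fix z assume "x \<le> z" "z \<le> y"
  then have "0 < z" using assms by simp
  then show "\<exists>d. (F_fun f has_real_derivative d) (at z) \<and> d < 0"
    using F_fun_has_derivative[of z] drift_pos[of z]
    by (intro exI[of _ "- (1 / f z)"]) simp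
qed

lemma F_fun_less_iff: "0 < x \<Longrightarrow> 0 < y \<Longrightarrow> F_fun f x < F_fun f y \<longleftrightarrow> y < x"
  using F_fun_strict_decreasing[of x y] F_fun_strict_decreasing[of y x]
  by (cases x y rule: linorder_cases) auto

lemma inj_on_F_fun: "inj_on (F_fun f) {0<..}"
  by (intro inj_onI) (metis F_fun_less_iff greaterThan_iff linorder_less_linear order_less_irrefl)

text \<open>The linear bound gives \<open>1 / f z \<ge> 1 / (L * z)\<close>, so
  \<open>F_fun f\<close> grows at least like a logarithm towards zero and exceeds \<open>t\<close>
  somewhere; since it vanishes at 1, the intermediate value theorem applies.\<close>

lemma F_fun_attains:
  assumes "0 \<le> t"
  obtains x where "0 < x" "x \<le> 1" "F_fun f x = t"
proof -
  obtain u L where u: "0 < u" "u \<le> 1" "0 < L" "\<And>x. 0 < x \<Longrightarrow> x \<le> u \<Longrightarrow> f x \<le> L * x"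
    by (rule linear_bound_at_0) blast
  \<comment> \<open>Chosen so that \<open>ln x / L\<close> lies exactly \<open>t\<close> below
    \<open>ln u / L\<close>; the monotonicity shown next then gives
    \<open>F_fun f x \<ge> F_fun f u + t\<close>.\<close>
  define x where "x = u * exp (- L * t)"
  have x: "0 < x" "x \<le> u" using u assms by (auto simp: x_def intro!: mult_le_cancel_left1[THEN iffD2])
  have "F_fun f u + ln u / L \<le> F_fun f x + ln x / L"
  proof (rule DERIV_nonpos_imp_nonincreasing[OF x(2)])
    fix z assume z: "x \<le> z" "z \<le> u"
    then have z0: "0 < z" using x by simp
    have "((\<lambda>x. F_fun f x + ln x / L) has_real_derivative (- (1 / f z) + 1 / z / L)) (at z)"
      using F_fun_has_derivative[OF z0] z0 u(3) by (auto intro!: derivative_eq_intros)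
    moreover have "1 / z / L \<le> 1 / f z"
      using u(4)[OF z0 z(2)] drift_pos[OF z0] z0 u(3)
      by (simp add: field_simps)
    ultimately show "\<exists>y. ((\<lambda>x. F_fun f x + ln x / L) has_real_derivative y) (at z) \<and> y \<le> 0"
      by force
  qed
  moreover have "ln x / L = ln u / L - t" using u by (simp add: x_def ln_mult diff_divide_distrib)
  moreover have "0 \<le> F_fun f u"
    using F_fun_less_iff[of u 1] u by (cases "u = 1") auto
  ultimately have "t \<le> F_fun f x" by linarith
  then have "\<exists>z\<ge>x. z \<le> 1 \<and> F_fun f z = t"
    using x u assms continuous_F_fun by (intro IVT2) auto
  then obtain z where "x \<le> z" "z \<le> 1" "F_fun f z = t" by blast
  then show ?thesis using that[of z] x by auto
qed

lemma F_inv_props: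
  assumes "0 \<le> t"
  shows F_inv_pos: "0 < F_inv f t" and F_inv_le_1: "F_inv f t \<le> 1"
    and F_fun_F_inv: "F_fun f (F_inv f t) = t"
proof -
  obtain x where x: "0 < x" "x \<le> 1" "F_fun f x = t" using F_fun_attains[OF assms] by blast
  then have "F_inv f t = x"
    unfolding F_inv_def using the_inv_into_f_f[OF inj_on_F_fun, of x] by simp
  then show "0 < F_inv f t" "F_inv f t \<le> 1" "F_fun f (F_inv f t) = t" using x by auto
qed

lemma F_inv_F_fun: "0 < x \<Longrightarrow> F_inv f (F_fun f x) = x"
  unfolding F_inv_def by (rule the_inv_into_f_f[OF inj_on_F_fun]) simp

lemma F_inv_strict_decreasing:
  assumes "0 \<le> s" "s < t"
  shows "F_inv f t < F_inv f s"
  using F_fun_less_iff[of "F_inv f s" "F_inv f t"] F_inv_props[of s] F_inv_props[of t] assms by auto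

lemma F_inv_decreasing: "0 \<le> s \<Longrightarrow> s \<le> t \<Longrightarrow> F_inv f t \<le> F_inv f s"
  using F_inv_strict_decreasing[of s t] by (cases "s = t") auto

lemma F_inv_tendsto_0:
  assumes "0 < r"
  obtains T where "0 < T" "\<And>t. T \<le> t \<Longrightarrow> F_inv f t < r"
proof -
  have "F_inv f t < r" if "max 0 (F_fun f r) + 1 \<le> t" for t
    using F_fun_less_iff[of r "F_inv f t"] F_inv_props[of t] assms that by auto
  then show ?thesis using that[of "max 0 (F_fun f r) + 1"] by auto
qed

lemma F_inv_has_derivative:
  assumes "0 < t"
  shows "(F_inv f has_real_derivative - f (F_inv f t)) (at t)"
proof -
  let ?y = "F_inv f t"
  have y: "0 < ?y" "F_fun f ?y = t" using F_inv_props assms by auto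
  have "isCont (F_inv f) (F_fun f ?y)"
    by (rule isCont_inverse_function2[of "?y / 2" _ "?y + 1"])
      (use y F_inv_F_fun continuous_F_fun in auto)
  then have "(F_inv f has_real_derivative inverse (- (1 / f ?y))) (at t)"
    using y F_fun_has_derivative[OF y(1)] drift_pos[OF y(1)] assms
    by (intro DERIV_inverse_function[where a = 0 and b = "t + 1"]) (auto simp: F_fun_F_inv)
  then show ?thesis by (simp add: field_simps)
qed

text \<open>\<open>F_inv f\<close> solves y' = -f(y), so the integral telescopes. As
  \<open>F_inv f\<close> takes values in (0,1], the drift along it has total mass at most 1.\<close>

lemma integral_drift_F_inv:
  assumes "0 < a" "a \<le> b"
  shows "((\<lambda>s. f (F_inv f s)) has_integral F_inv f a - F_inv f b) {a..b}"
proof -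
  have "((\<lambda>s. - f (F_inv f s)) has_integral F_inv f b - F_inv f a) {a..b}"
  proof (rule fundamental_theorem_of_calculus[OF assms(2)])
    fix x assume "x \<in> {a..b}"
    then show "(F_inv f has_vector_derivative - f (F_inv f x)) (at x within {a..b})"
      using F_inv_has_derivative[of x] assms
      by (auto simp flip: has_real_derivative_iff_has_vector_derivative
          intro: has_field_derivative_at_within)
  qed
  from has_integral_neg[OF this] show ?thesis by simp
qed

text \<open>Shrinking the argument by the factor \<open>1 - \<epsilon>\<close> lowers
  \<open>f\<close> near zero by at most a fixed factor. Finitely many shrinkings bring
  \<open>K * x\<close> below \<open>x\<close>, where monotonicity takes over.\<close>

lemma growth_bound:
  assumes mono: "mono f" and "0 < \<epsilon>" "\<epsilon> < 1" "Phi_lower f \<epsilon> > 0" and "0 < K"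
  obtains C r where "0 < C" "0 < r" "\<And>x. 0 < x \<Longrightarrow> x < r \<Longrightarrow> f (K * x) \<le> C * f x"
proof -
  let ?q = "1 - \<epsilon>"
  have q: "0 < ?q" "?q < 1" using assms by auto
  \<comment> \<open>A real \<open>c\<close> strictly below the positive lower limit bounds the ratio
    itself near zero; the lower limit may be infinite as an extended real.\<close>
  obtain c where c: "0 < ereal c" "ereal c < Phi_lower f \<epsilon>"
    using ereal_dense2[OF assms(4)] by blast
  then have "eventually (\<lambda>x. ereal c < ereal (f (?q * x) / f x)) (at_right 0)"
    unfolding Phi_lower_def by (intro less_LiminfD) simp
  then obtain d where d: "0 < d" "\<And>x. 0 < x \<Longrightarrow> x < d \<Longrightarrow> c < f (?q * x) / f x"
    unfolding eventually_at_right_field by auto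
  have step: "f x \<le> f (?q * x) / c" if "0 < x" "x < d" for x
    using d(2)[OF that] drift_pos[OF that(1)] c by (simp add: field_simps)
  have iter: "f x \<le> f (?q ^ n * x) / c ^ n" if "0 < x" "x < d" for x n
  proof (induction n)
    case (Suc n)
    have "?q ^ n * x \<le> 1 * x" using that q by (intro mult_right_mono power_le_one) auto
    then have "?q ^ n * x < d" using that by linarith
    then have "f (?q ^ n * x) \<le> f (?q * (?q ^ n * x)) / c"
      using that q by (intro step) auto
    then have "f (?q ^ n * x) / c ^ n \<le> f (?q * (?q ^ n * x)) / c / c ^ n"
      using c by (intro divide_right_mono) auto
    then show ?case using Suc by (simp add: mult.assoc)
  qed simp
  \<comment> \<open>The number of shrinkings that undoes the factor \<open>K\<close>.\<close>
  obtain n where n: "?q ^ n < 1 / K" using real_arch_pow_inv[of "1 / K" ?q] q assms by auto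
  have "f (K * x) \<le> 1 / c ^ n * f x" if "0 < x" "x < d / K" for x
  proof -
    have "f (K * x) \<le> f (?q ^ n * (K * x)) / c ^ n"
      using that assms by (intro iter) (auto simp: field_simps)
    also have "\<dots> \<le> f x / c ^ n"
    proof (intro divide_right_mono monoD[OF mono])
      have "(?q ^ n * K) * x \<le> 1 * x"
        using that n assms by (intro mult_right_mono) (auto simp: field_simps)
      then show "?q ^ n * (K * x) \<le> x" by (simp add: mult.assoc)
    qed (use c in auto)
    finally show ?thesis by simp
  qed
  then show ?thesis using that[of "1 / c ^ n" "d / K"] c d assms by auto
qed

end

subsection \<open>Unboundedness of the scaled solution\<close>

text \<open>Continuity of \<open>x\<close> carries a violation at \<open>t\<close> over to a rational time slightly to the right,
  where \<open>y\<close> is no larger.\<close>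

lemma rational_domination:
  fixes x y :: "real \<Rightarrow> real"
  assumes cont: "continuous_on {0..} x"
    and anti: "\<And>s t. 0 \<le> s \<Longrightarrow> s \<le> t \<Longrightarrow> y t \<le> y s"
    and "0 \<le> K" "0 \<le> T" and le: "\<And>t. t \<in> \<rat> \<Longrightarrow> T < t \<Longrightarrow> \<bar>x t\<bar> \<le> K * y t"
    and "T < t"
  shows "\<bar>x t\<bar> \<le> K * y t"
proof (rule ccontr)
  assume "\<not> ?thesis"
  then have "K * y t < \<bar>x t\<bar>" by simp
  moreover have "isCont x t"
    using continuous_on_interior[OF cont, of t] assms by simp
  then have "((\<lambda>s. \<bar>x s\<bar>) \<longlongrightarrow> \<bar>x t\<bar>) (at t)" by (intro tendsto_rabs isContD)
  ultimately have "eventually (\<lambda>s. K * y t < \<bar>x s\<bar>) (at t)" by (rule order_tendstoD(1)[rotated])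
  then have "eventually (\<lambda>s. K * y t < \<bar>x s\<bar>) (at_right t)" by (simp add: eventually_at_split)
  then obtain b where b: "t < b" "\<And>s. t < s \<Longrightarrow> s < b \<Longrightarrow> K * y t < \<bar>x s\<bar>"
    unfolding eventually_at_right_field by blast
  obtain s where s: "s \<in> \<rat>" "t < s" "s < b" using Rats_dense_in_real[OF b(1)] by blast
  have "\<bar>x s\<bar> \<le> K * y s" using s assms by (intro le) auto
  also have "\<dots> \<le> K * y t" using s assms by (intro mult_left_mono anti) auto
  finally show False using b(2)[OF s(2,3)] by simp
qed

text \<open>Reduces the event to countably many times, hence shows that it is measurable.\<close>

lemma Limsup_ratio_eq_infinity_iff:
  fixes x y :: "real \<Rightarrow> real"
  assumes cont: "continuous_on {0..} x"
    and anti: "\<And>s t. 0 \<le> s \<Longrightarrow> s \<le> t \<Longrightarrow> y t \<le> y s"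
    and pos: "\<And>t. 0 \<le> t \<Longrightarrow> 0 < y t"
  shows "Limsup at_top (\<lambda>t. ereal (\<bar>x t\<bar> / y t)) = \<infinity> \<longleftrightarrow>
    (\<forall>K T::nat. \<exists>t\<in>\<rat>. real T < t \<and> real K * y t < \<bar>x t\<bar>)"
proof
  assume L: "Limsup at_top (\<lambda>t. ereal (\<bar>x t\<bar> / y t)) = \<infinity>"
  show "\<forall>K T::nat. \<exists>t\<in>\<rat>. real T < t \<and> real K * y t < \<bar>x t\<bar>"
  proof (rule ccontr)
    assume "\<not> ?thesis"
    then obtain K T :: nat where "\<And>t. t \<in> \<rat> \<Longrightarrow> real T < t \<Longrightarrow> \<bar>x t\<bar> \<le> real K * y t"
      by (meson not_less)
    then have le: "\<bar>x t\<bar> \<le> real K * y t" if "real T < t" for t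
      using rational_domination[of x y "real K" "real T" t, OF cont anti] that by simp
    have "eventually (\<lambda>t. ereal (\<bar>x t\<bar> / y t) \<le> ereal (real K)) at_top"
      using eventually_gt_at_top[of "real T"]
    proof eventually_elim
      case (elim t)
      then have "0 < y t" by (intro pos) linarith
      then show ?case using le[OF elim] by (simp add: divide_le_eq)
    qed
    then have "Limsup at_top (\<lambda>t. ereal (\<bar>x t\<bar> / y t)) \<le> ereal (real K)" by (rule Limsup_bounded)
    then show False using L by simp
  qed
next
  assume R: "\<forall>K T::nat. \<exists>t\<in>\<rat>. real T < t \<and> real K * y t < \<bar>x t\<bar>"
  show "Limsup at_top (\<lambda>t. ereal (\<bar>x t\<bar> / y t)) = \<infinity>"
  proof (rule ccontr)
    assume "\<not> ?thesis"
    then obtain k where "Limsup at_top (\<lambda>t. ereal (\<bar>x t\<bar> / y t)) < ereal k"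
      using less_PInf_Ex_of_nat by (metis ereal_infty_less(1))
    then have "eventually (\<lambda>t. ereal (\<bar>x t\<bar> / y t) < ereal k) at_top" by (rule Limsup_lessD)
    then obtain T where T: "\<And>t. T \<le> t \<Longrightarrow> \<bar>x t\<bar> / y t < k"
      by (auto simp: eventually_at_top_linorder)
    \<comment> \<open>Rounding up through \<open>nat\<close> also covers negative \<open>T\<close>
      and \<open>k\<close>, which become 0.\<close>
    obtain t where t: "real (nat \<lceil>T\<rceil>) < t" "real (nat \<lceil>k\<rceil>) * y t < \<bar>x t\<bar>" using R by blast
    have "0 < y t" using t by (intro pos) linarith
    have "T \<le> t" using t(1) by linarith
    then have "\<bar>x t\<bar> < k * y t" using T \<open>0 < y t\<close> by (simp add: divide_less_eq)
    also have "\<dots> \<le> real (nat \<lceil>k\<rceil>) * y t" using \<open>0 < y t\<close> by (intro mult_right_mono) linarith+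
    finally show False using t(2) by simp
  qed
qed

text \<open>A pathwise statement: domination by \<open>F_inv f\<close> makes the drift integrable up
  to infinity, and the integral equation can then be solved for a bounded \<open>i\<close>. One
  number \<open>N\<close> serves as starting time and as bound, so that failure is a countable union
  over \<open>N\<close>.\<close>

lemma (in drift_function) bounded_forcing:
  fixes x i :: "real \<Rightarrow> real"
  assumes mono: "mono f" and odd: "\<And>x. f (- x) = - f x"
    and \<epsilon>: "0 < \<epsilon>" "\<epsilon> < 1" "Phi_lower f \<epsilon> > 0"
    and cont: "continuous_on {0..} x"
    and dom: "\<And>t. T < t \<Longrightarrow> \<bar>x t\<bar> \<le> K * F_inv f t" and "0 \<le> K"
    and eq: "\<And>t. 0 \<le> t \<Longrightarrow> x t = \<xi> - (LBINT s:{0..t}. f (x s)) + i t"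
  shows "\<exists>N::nat. \<forall>n\<ge>N. \<bar>i (real n)\<bar> \<le> real N"
proof -
  \<comment> \<open>\<open>K + 1\<close> replaces \<open>K\<close> because
    \<open>growth_bound\<close> asks for a positive factor and \<open>K\<close> may be 0.\<close>
  obtain C r where C: "0 < C" "0 < r" "\<And>z. 0 < z \<Longrightarrow> z < r \<Longrightarrow> f ((K + 1) * z) \<le> C * f z"
    using growth_bound[OF mono \<epsilon>, of "K + 1"] \<open>0 \<le> K\<close> by (metis add_nonneg_pos zero_less_one)
  obtain T1 where T1: "0 < T1" "\<And>t. T1 \<le> t \<Longrightarrow> F_inv f t < r"
    using F_inv_tendsto_0[OF C(2)] by blast
  \<comment> \<open>From time \<open>a\<close> on, the domination holds and \<open>F_inv f\<close>
    is small enough for the growth bound.\<close>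
  define a where "a = max T1 (T + 1)"
  have a: "0 < a" "T < a" "T1 \<le> a" using T1 by (auto simp: a_def)
  have contf: "continuous_on {u..v} (\<lambda>s. f (x s))" if "0 \<le> u" for u v
    by (rule continuous_on_compose2[OF continuous_drift, of _ x])
      (use that in \<open>auto intro: continuous_on_subset[OF cont]\<close>)
  have x: "\<bar>x t\<bar> \<le> (K + 1) * F_inv f t" if "a \<le> t" for t
    using dom[of t] F_inv_pos[of t] a that by (simp add: algebra_simps)
  have fx: "norm (f (x t)) \<le> C * f (F_inv f t)" if "a \<le> t" for t
  proof -
    have "\<bar>f (x t)\<bar> \<le> f \<bar>x t\<bar>"
      using odd[of "x t"] zero drift_pos[of "x t"] drift_pos[of "- x t"]
      by (cases "x t" "0::real" rule: linorder_cases) auto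
    also have "\<dots> \<le> f ((K + 1) * F_inv f t)" using x[OF that] by (rule monoD[OF mono])
    also have "\<dots> \<le> C * f (F_inv f t)" using T1 a that by (intro C F_inv_pos) auto
    finally show ?thesis by simp
  qed
  define A where "A = \<bar>\<xi>\<bar> + \<bar>integral {0..a} (\<lambda>s. f (x s))\<bar>"
  \<comment> \<open>\<open>A\<close> covers the initial value and the drift up to \<open>a\<close>,
    \<open>C\<close> the drift after \<open>a\<close>, and \<open>K + 1\<close> the value of
    \<open>x\<close> itself.\<close>
  define R where "R = A + C + (K + 1)"
  have bound: "\<bar>i t\<bar> \<le> R" if t: "a \<le> t" for t
  proof -
    have t0: "0 \<le> t" using t a by simp
    have int: "(\<lambda>s. f (x s)) integrable_on {u..v}" if "0 \<le> u" for u v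
      using contf[OF that] by (rule integrable_continuous_real)
    have "set_integrable lborel {0..t} (\<lambda>s. f (x s))"
      by (rule borel_integrable_atLeastAtMost'[OF contf]) simp
    then have "(LBINT s:{0..t}. f (x s)) = integral {0..t} (\<lambda>s. f (x s))"
      by (rule set_borel_integral_eq_integral(2))
    also have "\<dots> = integral {0..a} (\<lambda>s. f (x s)) + integral {a..t} (\<lambda>s. f (x s))"
      using a t by (intro Henstock_Kurzweil_Integration.integral_combine[symmetric] int) auto
    finally have split: "(LBINT s:{0..t}. f (x s)) =
        integral {0..a} (\<lambda>s. f (x s)) + integral {a..t} (\<lambda>s. f (x s))" .
    have Y: "((\<lambda>s. C * f (F_inv f s)) has_integral C * (F_inv f a - F_inv f t)) {a..t}"
      by (rule has_integral_mult_right[OF integral_drift_F_inv[OF a(1) t]])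
    have "norm (integral {a..t} (\<lambda>s. f (x s))) \<le> integral {a..t} (\<lambda>s. C * f (F_inv f s))"
      using fx a Y by (intro integral_norm_bound_integral int) auto
    also have "\<dots> = C * (F_inv f a - F_inv f t)" using Y by (rule integral_unique)
    also have "\<dots> \<le> C * 1"
      using F_inv_le_1[of a] F_inv_pos[OF t0] a C by (intro mult_left_mono) auto
    finally have D: "\<bar>integral {a..t} (\<lambda>s. f (x s))\<bar> \<le> C" by simp
    have xt: "\<bar>x t\<bar> \<le> (K + 1) * 1"
      by (rule order_trans[OF x[OF t]]) (use F_inv_le_1[OF t0] \<open>0 \<le> K\<close> in \<open>intro mult_left_mono, auto\<close>)
    have "\<bar>i t\<bar> \<le> \<bar>x t\<bar> + A + \<bar>integral {a..t} (\<lambda>s. f (x s))\<bar>"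
      using eq[OF t0] unfolding split A_def by linarith
    also have "\<dots> \<le> (K + 1) * 1 + A + C" by (intro add_mono xt D order_refl)
    finally show ?thesis unfolding R_def by simp
  qed
  define N where "N = nat \<lceil>max a R\<rceil>"
  have N: "a \<le> real N" "R \<le> real N" unfolding N_def by linarith+
  have "\<bar>i (real n)\<bar> \<le> real N" if "N \<le> n" for n
  proof -
    have "a \<le> real n" using N(1) that by linarith
    then show ?thesis using bound[of "real n"] N(2) by linarith
  qed
  then show ?thesis by blast
qed

section \<open>Unboundedness of the stochastic integral\<close>

text \<open>The measure with density the square of \<open>\<sigma>\<close> has infinite mass on the
  half-line, since finite mass would mean integrability. Continuity from below along the intervals
  \<open>{0..real n}\<close> carries this over to large finite times.\<close>

lemma energy_unbounded:
  assumes cont: "continuous_on {0..} \<sigma>"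
    and nint: "\<not> set_integrable lborel {0<..} (\<lambda>t. (\<sigma> t :: real)\<^sup>2)"
  obtains n0 :: nat where
    "\<And>n. n0 \<le> n \<Longrightarrow> ennreal V \<le> (\<integral>\<^sup>+t\<in>{0..real n}. ennreal ((\<sigma> t)\<^sup>2) \<partial>lborel)"
proof -
  define s where "s t = indicator {0..} t *\<^sub>R \<sigma> t" for t
  have [measurable]: "s \<in> borel_measurable borel"
    unfolding s_def[abs_def] by (rule borel_measurable_continuous_on_indicator[OF _ cont]) simp
  define N where "N = density lborel (\<lambda>t. ennreal ((s t)\<^sup>2))"
  have N: "emeasure N A = (\<integral>\<^sup>+t\<in>A. ennreal ((\<sigma> t)\<^sup>2) \<partial>lborel)" if "A \<subseteq> {0..}" "A \<in> sets borel" for A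
  proof -
    have "emeasure N A = (\<integral>\<^sup>+t\<in>A. ennreal ((s t)\<^sup>2) \<partial>lborel)"
      unfolding N_def using that by (subst emeasure_density) auto
    also have "\<dots> = (\<integral>\<^sup>+t\<in>A. ennreal ((\<sigma> t)\<^sup>2) \<partial>lborel)"
      using that by (intro nn_integral_cong) (auto simp: s_def split: split_indicator)
    finally show ?thesis .
  qed
  have "emeasure N {0<..} = \<infinity>"
  proof (rule ccontr)
    assume "\<not> ?thesis"
    then have fin: "(\<integral>\<^sup>+t\<in>{0<..}. ennreal ((\<sigma> t)\<^sup>2) \<partial>lborel) < \<infinity>"
      by (subst N[symmetric]) (auto simp: less_top)
    have eq: "indicator {0<..} t *\<^sub>R (\<sigma> t)\<^sup>2 = indicator {0<..} t * (s t)\<^sup>2" for t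
      by (auto simp: s_def split: split_indicator)
    have "integrable lborel (\<lambda>t. indicator {0<..} t * (s t)\<^sup>2)"
    proof (rule integrableI_nonneg)
      have "(\<integral>\<^sup>+t. ennreal (indicator {0<..} t * (s t)\<^sup>2) \<partial>lborel) =
          (\<integral>\<^sup>+t\<in>{0<..}. ennreal ((\<sigma> t)\<^sup>2) \<partial>lborel)"
        by (intro nn_integral_cong) (auto simp: s_def split: split_indicator)
      then show "(\<integral>\<^sup>+t. ennreal (indicator {0<..} t * (s t)\<^sup>2) \<partial>lborel) < \<infinity>" using fin by simp
    qed auto
    then show False using nint unfolding set_integrable_def eq by simp
  qed
  moreover have "emeasure N {0<..} \<le> emeasure N {0..}" by (rule emeasure_mono) (auto simp: N_def)
  ultimately have "emeasure N {0..} = \<infinity>" by (simp add: top.extremum_unique)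
  moreover have "(\<Union>n. {0..real n}) = {0..}"
    by (auto intro: real_arch_simple)
  moreover have "(SUP n. emeasure N {0..real n}) = emeasure N (\<Union>n. {0..real n})"
    by (rule SUP_emeasure_incseq) (auto simp: N_def incseq_def)
  ultimately have "(SUP n. emeasure N {0..real n}) = \<infinity>" by simp
  then have "ennreal V < (SUP n. emeasure N {0..real n})"
    by (metis ennreal_less_top infinity_ennreal_def)
  then obtain n0 where n0: "ennreal V < emeasure N {0..real n0}" by (auto simp: less_SUP_iff)
  have "ennreal V \<le> (\<integral>\<^sup>+t\<in>{0..real n}. ennreal ((\<sigma> t)\<^sup>2) \<partial>lborel)" if "n0 \<le> n" for n
  proof -
    have "emeasure N {0..real n0} \<le> emeasure N {0..real n}"
      using that by (intro emeasure_mono) (auto simp: N_def)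
    then show ?thesis using n0 N[of "{0..real n}"] by auto
  qed
  then show ?thesis using that by blast
qed

text \<open>For fixed \<open>N\<close>, the event is contained in a single-time event at every
  integer \<open>n \<ge> N\<close>, and anticoncentration makes the latter arbitrarily unlikely as
  the energy grows. Countably many \<open>N\<close> are then combined.\<close>

lemma (in brownian_motion) ito_integral_unbounded:
  assumes ito: "\<And>t. 0 \<le> t \<Longrightarrow> has_ito_integral M \<F> B t (\<lambda>s _. \<sigma> s) (I t)"
    and cont: "continuous_on {0..} \<sigma>"
    and nint: "\<not> set_integrable lborel {0<..} (\<lambda>t. (\<sigma> t)\<^sup>2)"
  shows "AE \<omega> in M. \<not> (\<exists>N::nat. \<forall>n\<ge>N. \<bar>I (real n) \<omega>\<bar> \<le> real N)"
proof -
  have [measurable]: "I (real n) \<in> borel_measurable M" for n :: nat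
    using ito[of "real n"] unfolding has_ito_integral_def by simp
  have "AE \<omega> in M. \<not> (\<forall>n\<ge>N. \<bar>I (real n) \<omega>\<bar> \<le> real N)" for N :: nat
  proof -
    let ?A = "{\<omega>\<in>space M. \<forall>n\<ge>N. \<bar>I (real n) \<omega>\<bar> \<le> real N}"
    have "prob ?A \<le> 0"
    proof (rule field_le_epsilon)
      fix \<epsilon> :: real assume \<epsilon>: "0 < \<epsilon>"
      \<comment> \<open>Solves \<open>4 * (real N + 1) / sqrt V = \<epsilon>\<close> for
        \<open>V\<close>.\<close>
      define V where "V = (4 * (real N + 1) / \<epsilon>)\<^sup>2"
      have V: "0 < V" "sqrt V = 4 * (real N + 1) / \<epsilon>" using \<epsilon> by (auto simp: V_def)
      obtain n0 where n0: "\<And>n. n0 \<le> n \<Longrightarrow>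
          ennreal V \<le> (\<integral>\<^sup>+t\<in>{0..real n}. ennreal ((\<sigma> t)\<^sup>2) \<partial>lborel)"
        using energy_unbounded[OF cont nint] by blast
      \<comment> \<open>Late enough for the energy to reach \<open>V\<close> and for the bound by
        \<open>N\<close> to be in force.\<close>
      define n where "n = max n0 N"
      have "prob ?A \<le> \<P>(\<omega> in M. \<bar>I (real n) \<omega>\<bar> \<le> real N)"
        by (rule finite_measure_mono) (auto simp: n_def)
      also have "\<dots> \<le> 4 * (real N + 1) / sqrt V"
        by (rule ito_integral_anticoncentration[OF ito cont V(1) n0]) (auto simp: n_def)
      also have "\<dots> = \<epsilon>" unfolding V(2) using \<epsilon> by simp
      finally show "prob ?A \<le> 0 + \<epsilon>" by simp
    qed
    then have "prob ?A = 0" by (simp add: measure_le_0_iff)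
    then show ?thesis by (subst (asm) prob_Collect_eq_0) auto
  qed
  then show ?thesis by (simp add: AE_all_countable)
qed

theorem theorem17:
  fixes M :: "'a measure" and B X :: "real \<Rightarrow> 'a \<Rightarrow> real"
    and f \<sigma> :: "real \<Rightarrow> real" and \<xi> :: real
  assumes "local_lipschitz (UNIV :: real set) UNIV (\<lambda>_. f)"
    and "mono f"
    and "\<And>x. f (- x) = - f x"
    and "f 0 = 0"
    and "\<And>x. x \<noteq> 0 \<Longrightarrow> x * f x > 0"
    and "\<exists>\<epsilon>\<^sub>0\<in>{0<..<1}. \<forall>\<epsilon>\<in>{0<..<\<epsilon>\<^sub>0}. Phi_lower f \<epsilon> > 0"
    and "(Phi_lower f \<longlongrightarrow> 1) (at_right 0)"
    and "\<And>\<mu>. \<mu> \<in> {0<..<1} \<Longrightarrow>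
           Limsup (at_right 0) (\<lambda>x. ereal (f (\<mu> * x) / f x)) < ereal \<mu>"
    and "continuous_on {0..} \<sigma>"
    and "\<not> set_integrable lborel {0<..} (\<lambda>t. (\<sigma> t)\<^sup>2)"
    and "standard_brownian_motion M B"
    and "solves_sde M B f \<sigma> \<xi> X"
  shows "\<P>(\<omega> in M. Limsup at_top (\<lambda>t. ereal (\<bar>X t \<omega>\<bar> / F_inv f t)) = \<infinity>) = 1"
proof -
  interpret prob_space M
    using assms(11) unfolding standard_brownian_motion_def by blast
  interpret brownian_motion M B by unfold_locales (rule assms(11))
  interpret drift_function f by unfold_locales (use assms in auto)
  let ?y = "F_inv f"
  let ?P = "\<lambda>\<omega>. \<forall>K T::nat. \<exists>t\<in>\<rat>. real T < t \<and> real K * ?y t < \<bar>X t \<omega>\<bar>"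
  obtain \<epsilon>0 where "0 < \<epsilon>0" "\<epsilon>0 < 1" "\<forall>\<epsilon>\<in>{0<..<\<epsilon>0}. Phi_lower f \<epsilon> > 0"
    using assms(6) by auto
  \<comment> \<open>The growth bound works with one fixed ratio; the midpoint of the admissible
    range supplies it.\<close>
  then have \<epsilon>: "0 < \<epsilon>0 / 2" "\<epsilon>0 / 2 < 1" "Phi_lower f (\<epsilon>0 / 2) > 0" by auto
  have adapted: "adapted_process \<F> X"
    and cont: "\<And>\<omega>. \<omega> \<in> space M \<Longrightarrow> continuous_on {0..} (\<lambda>t. X t \<omega>)"
    using assms(12) unfolding solves_sde_def by auto
  obtain I where I: "\<And>t. 0 \<le> t \<Longrightarrow> has_ito_integral M \<F> B t (\<lambda>s _. \<sigma> s) (I t)"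
    "AE \<omega> in M. \<forall>t\<ge>0. X t \<omega> = \<xi> - (LBINT s:{0..t}. f (X s \<omega>)) + I t \<omega>"
    using assms(12) unfolding solves_sde_def by blast

  have meas: "{\<omega>\<in>space M. ?P \<omega>} \<in> events"
  proof -
    have "{\<omega>\<in>space M. real T < t \<and> real K * ?y t < \<bar>X t \<omega>\<bar>} \<in> events" for t and K T :: nat
    proof (cases "real T < t")
      case True
      then have "0 \<le> t" by (simp add: le_less_trans[THEN less_imp_le, of _ "real T"])
      then have [measurable]: "X t \<in> borel_measurable M"
        using adapted measurable_augmented unfolding adapted_process_def by blast
      show ?thesis by measurable
    qed simp
    then show ?thesis
      by (intro sets.sets_Collect_countable_All sets.sets_Collect_countable_Ex' countable_rat)
  qed

  have "AE \<omega> in M. \<not> (\<exists>N::nat. \<forall>n\<ge>N. \<bar>I (real n) \<omega>\<bar> \<le> real N)"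
    using I(1) by (rule ito_integral_unbounded[OF _ assms(9,10)])
  \<comment> \<open>On a path where the integral equation holds and \<open>I\<close> is unbounded
    along the integers, failure of \<open>?P\<close> would give domination by a multiple of
    \<open>?y\<close>, first at rational and then at all late times, and hence a bounded
    \<open>I\<close>.\<close>
  with I(2) AE_space have "AE \<omega> in M. ?P \<omega>"
  proof eventually_elim
    case (elim \<omega>)
    show "?P \<omega>"
    proof (rule ccontr)
      assume "\<not> ?P \<omega>"
      then obtain K T :: nat
        where "\<And>t. t \<in> \<rat> \<Longrightarrow> real T < t \<Longrightarrow> \<bar>X t \<omega>\<bar> \<le> real K * ?y t"
        by (meson not_less)
      then have "\<bar>X t \<omega>\<bar> \<le> real K * ?y t" if "real T < t" for t
        using rational_domination[of "\<lambda>t. X t \<omega>" ?y "real K" "real T" t,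
            OF cont[OF elim(2)] F_inv_decreasing] that
        by simp
      then have "\<exists>N::nat. \<forall>n\<ge>N. \<bar>I (real n) \<omega>\<bar> \<le> real N"
        using bounded_forcing[OF assms(2,3) \<epsilon> cont[OF elim(2)], of "real T" "real K" \<xi> "\<lambda>t. I t \<omega>"]
          elim(1) by auto
      then show False using elim(3) by blast
    qed
  qed
  then have "\<P>(\<omega> in M. ?P \<omega>) = 1" using prob_Collect_eq_1[OF meas] by blast
  moreover have "{\<omega>\<in>space M. Limsup at_top (\<lambda>t. ereal (\<bar>X t \<omega>\<bar> / ?y t)) = \<infinity>} = {\<omega>\<in>space M. ?P \<omega>}"
    using Limsup_ratio_eq_infinity_iff[OF cont F_inv_decreasing F_inv_pos] by auto
  ultimately show ?thesis by simp
qed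

end
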